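(* Let $\mathcal{A}_0=\mathcal{C}_0\cup\mathcal{C}_1$ be generic among the realizations of $M_8$, where $\mathcal{C}_0$ (resp. $\mathcal{C}_1$) denotes the first (resp. last) eight lines. Then the labeled line arrangement $\mathcal{C}_2=\Lambda^{\ell}_{\{2\},\{3,4\}}(\mathcal{C}_1)$ consists of $8$ lines and $\mathcal{A}_1=\mathcal{C}_1\cup\mathcal{C}_2$ is a realization of $M_8$.
   Context: Over $\mathbb{C}$. For a labeled arrangement $(\ell_1,\dots,\ell_8)$ of lines in $\mathbb{P}^2$ put $p_{i,j}=\ell_i\cap\ell_j$ and $S_1=\{p_{1,8},p_{2,7},p_{3,6},p_{4,5}\}$, $S_2=\{p_{1,7},p_{2,6},p_{3,5}\}$, $S_3=\{p_{1,6},p_{2,5},p_{3,4},p_{7,8}\}$, $S_4=\{p_{1,5},p_{2,4},p_{6,8}\}$, $S_5=\{p_{1,4},p_{2,3},p_{5,8},p_{6,7}\}$, $S_6=\{p_{1,3},p_{4,8},p_{5,7}\}$, $S_7=\{p_{1,2},p_{3,8},p_{4,7},p_{5,6}\}$, $S_8=\{p_{2,8},p_{3,7},p_{4,6}\}$. The operator $\Lambda^{\ell}_{\{2\},\{3,4\}}$ sends $(\ell_1,\dots,\ell_8)$ to $(\ell'_1,\dots,\ell'_8)$ where $\ell'_k$ is the line containing all points of $S_k$ (or empty if there is none). $M_8$ is the rank-3 matroid on $\{1,\dots,8,1',\dots,8'\}$ in which every 3-subset is a basis except the 28 triples $\{i,j,k'\}$ with $p_{i,j}\in S_k$ (combinatorially: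 the regular octagon and its 8 symmetry axes, with the central point discarded). A realization of $M_8$ is a labeled family of 16 distinct lines such that three of them are concurrent iff their labels form a non-basis; for a realization $\mathcal{C}_0\cup\mathcal{C}_1$, $\mathcal{C}_1=\Lambda^{\ell}_{\{2\},\{3,4\}}(\mathcal{C}_0)$. In $\mathcal{A}_1$ the lines of $\mathcal{C}_1$ carry labels $1,\dots,8$ and those of $\mathcal{C}_2$ labels $1',\dots,8'$. *)

theory Defs
  imports "HOL-Analysis.Finite_Cartesian_Product"
begin

section \<open>Projective lines in P^2(C) as nonzero vectors of complex^3\<close>

definition dot3 :: "complex^3 \<Rightarrow> complex^3 \<Rightarrow> complex" where
  "dot3 v w = v$1 * w$1 + v$2 * w$2 + v$3 * w$3"

definition cross3c :: "complex^3 \<Rightarrow> complex^3 \<Rightarrow> complex^3" where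
  "cross3c v w = (\<chi> i. if i = 1 then v$2 * w$3 - v$3 * w$2
                     else if i = 2 then v$3 * w$1 - v$1 * w$3
                     else v$1 * w$2 - v$2 * w$1)"

definition det3 :: "complex^3 \<Rightarrow> complex^3 \<Rightarrow> complex^3 \<Rightarrow> complex" where
  "det3 u v w = dot3 u (cross3c v w)"

definition same_proj :: "complex^3 \<Rightarrow> complex^3 \<Rightarrow> bool" where
  "same_proj v w \<longleftrightarrow> cross3c v w = 0"

datatype lab = Ul nat | Pl nat   \<comment> \<open>Ul i = label i, Pl k = label k'\<close>

definition ground :: "lab set" where
  "ground = Ul ` {1..8} \<union> Pl ` {1..8}"

definition Spairs :: "nat \<Rightarrow> (nat \<times> nat) set" where
  "Spairs k = (if k = 1 then {(1,8),(2,7),(3,6),(4,5)}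
    else if k = 2 then {(1,7),(2,6),(3,5)}
    else if k = 3 then {(1,6),(2,5),(3,4),(7,8)}
    else if k = 4 then {(1,5),(2,4),(6,8)}
    else if k = 5 then {(1,4),(2,3),(5,8),(6,7)}
    else if k = 6 then {(1,3),(4,8),(5,7)}
    else if k = 7 then {(1,2),(3,8),(4,7),(5,6)}
    else if k = 8 then {(2,8),(3,7),(4,6)}
    else {})"

definition nonbasis :: "lab set \<Rightarrow> bool" where
  "nonbasis T \<longleftrightarrow> (\<exists>i j k. (i, j) \<in> Spairs k \<and> T = {Ul i, Ul j, Pl k})"

definition realization :: "(lab \<Rightarrow> complex^3) \<Rightarrow> bool" where
  "realization L \<longleftrightarrow>
     (\<forall>e\<in>ground. L e \<noteq> 0) \<and>
     (\<forall>e\<in>ground. \<forall>e'\<in>ground. e \<noteq> e' \<longrightarrow> \<not> same_proj (L e) (L e')) \<and>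
     (\<forall>a\<in>ground. \<forall>b\<in>ground. \<forall>c\<in>ground. distinct [a, b, c] \<longrightarrow>
        (det3 (L a) (L b) (L c) = 0 \<longleftrightarrow> nonbasis {a, b, c}))"

text \<open>For a labeled arrangement C (lines C 1, ..., C 8): p_{i,j} = C i \<inter> C j.\<close>
definition ipt :: "(nat \<Rightarrow> complex^3) \<Rightarrow> nat \<Rightarrow> nat \<Rightarrow> complex^3" where
  "ipt C i j = cross3c (C i) (C j)"

definition Sset :: "(nat \<Rightarrow> complex^3) \<Rightarrow> nat \<Rightarrow> (complex^3) set" where
  "Sset C k = {ipt C i j | i j. (i, j) \<in> Spairs k}"

definition line_through_S :: "(nat \<Rightarrow> complex^3) \<Rightarrow> nat \<Rightarrow> complex^3 \<Rightarrow> bool" where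
  "line_through_S C k v \<longleftrightarrow> v \<noteq> 0 \<and> (\<forall>p\<in>Sset C k. dot3 v p = 0)"

definition Lambda :: "(nat \<Rightarrow> complex^3) \<Rightarrow> nat \<Rightarrow> (complex^3) option" where
  "Lambda C k = (if \<exists>v. line_through_S C k v \<and> (\<forall>w. line_through_S C k w \<longrightarrow> same_proj v w)
                 then Some (SOME v. line_through_S C k v) else None)"

inductive_set polyfun :: "(('v \<Rightarrow> complex) \<Rightarrow> complex) set" where
  pconst: "(\<lambda>x. c) \<in> polyfun"
| pvar: "(\<lambda>x. x v) \<in> polyfun"
| padd: "f \<in> polyfun \<Longrightarrow> g \<in> polyfun \<Longrightarrow> (\<lambda>x. f x + g x) \<in> polyfun"
| pmult: "f \<in> polyfun \<Longrightarrow> g \<in> polyfun \<Longrightarrow> (\<lambda>x. f x * g x) \<in> polyfun"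

definition coords :: "(lab \<Rightarrow> complex^3) \<Rightarrow> (lab \<times> 3 \<Rightarrow> complex)" where
  "coords L = (\<lambda>(e, i). if e \<in> ground then L e $ i else 0)"

text \<open>P holds for generic members of R: there is a Zariski-closed set Z (zero set
  of a family F of polynomials) whose complement in R is Zariski-dense in R, and
  P holds on R minus Z.\<close>
definition holds_generically ::
  "((lab \<Rightarrow> complex^3) \<Rightarrow> bool) \<Rightarrow> ((lab \<Rightarrow> complex^3) \<Rightarrow> bool) \<Rightarrow> bool" where
  "holds_generically R P \<longleftrightarrow>
     (\<exists>F \<subseteq> polyfun.
        (\<forall>g \<in> polyfun.
           (\<forall>L. R L \<and> \<not> (\<forall>f\<in>F. f (coords L) = 0) \<longrightarrow> g (coords L) = 0) \<longrightarrow>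
           (\<forall>L. R L \<longrightarrow> g (coords L) = 0)) \<and>
        (\<forall>L. R L \<and> \<not> (\<forall>f\<in>F. f (coords L) = 0) \<longrightarrow> P L))"

end

theory Submission
  imports Defs "HOL-Analysis.Analysis" "HOL-Computational_Algebra.Polynomial" "HOL-Number_Theory.Cong"
begin

text \<open>
  Dually, a realization of \<open>M\<^sub>8\<close> is a set of points \<open>P\<^sub>i = \<alpha> + i \<tau>\<close> and \<open>Q\<^sub>s = - 2 \<alpha> - s \<tau>\<close> on a plane cubic,
  with \<open>\<tau>\<close> of order 8, and \<open>P\<^sub>i, P\<^sub>j, Q\<^bsub>i+j\<^esub>\<close> collinear. In explicit terms: after a projective change of
  coordinates every realization is \<open>cfg t b c\<close>, where \<open>c\<close> is a root of a monic quadratic polynomial over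
  \<open>\<complex>[t, b]\<close>. The concurrencies required for the new lines are polynomial identities modulo this
  quadratic, and so hold for every realization.

  The non-concurrencies hold off the zero set of one polynomial, the product of the minors of
  the new arrangement. For density, join \<open>(t, b)\<close> to \<open>(-1, 2)\<close> by a line with parameter \<open>x\<close>. A minor restricts to
  \<open>p(x) + q(x) c\<close>, whose norm is a polynomial in \<open>x\<close>; this norm is not zero at \<open>(-1, 2)\<close>, by a computation
  modulo 7. So near \<open>x = 0\<close> all minors are nonzero, and the roots \<open>c\<close> vary continuously.
\<close>

section \<open>Vectors of length three\<close>

definition vec3 :: "complex \<Rightarrow> complex \<Rightarrow> complex \<Rightarrow> complex^3" where
  "vec3 x y z = (\<chi> i. if i = 1 then x else if i = 2 then y else z)"

lemma vec3_nth [simp]: "vec3 x y z $ 1 = x" "vec3 x y z $ 2 = y" "vec3 x y z $ 3 = z"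
  by (simp_all add: vec3_def)

lemma vec_eq_3: "v = w \<longleftrightarrow> v$1 = w$1 \<and> v$2 = w$2 \<and> v$3 = w$3" for v w :: "complex^3"
  by (simp add: vec_eq_iff forall_3)

lemma cross3c_nth [simp]:
  "cross3c v w $ 1 = v$2 * w$3 - v$3 * w$2"
  "cross3c v w $ 2 = v$3 * w$1 - v$1 * w$3"
  "cross3c v w $ 3 = v$1 * w$2 - v$2 * w$1"
  by (simp_all add: cross3c_def)

lemma det3_expand: "det3 u v w = u$1 * (v$2 * w$3 - v$3 * w$2) + u$2 * (v$3 * w$1 - v$1 * w$3)
    + u$3 * (v$1 * w$2 - v$2 * w$1)"
  by (simp add: det3_def dot3_def)

lemma det3_swap: "det3 v u w = - det3 u v w" "det3 u w v = - det3 u v w"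
  by (simp_all add: det3_expand algebra_simps)

lemma det3_eq_0_perm:
  assumes "det3 u v w = 0"
  shows "det3 v u w = 0" "det3 u w v = 0" "det3 v w u = 0" "det3 w u v = 0" "det3 w v u = 0"
proof -
  have s: "det3 y x z = 0" "det3 x z y = 0" if "det3 x y z = 0" for x y z
    using that det3_swap[of x y z] by simp_all
  show "det3 v u w = 0" "det3 u w v = 0" by (fact s[OF assms])+
  show "det3 v w u = 0" by (fact s(2)[OF s(1)[OF assms]])
  show "det3 w u v = 0" by (fact s(1)[OF s(2)[OF assms]])
  show "det3 w v u = 0" by (fact s(2)[OF s(1)[OF s(2)[OF assms]]])
qed

lemma dot3_cross3c: "dot3 w (cross3c u v) = det3 u v w"
  by (simp add: det3_expand dot3_def algebra_simps)

lemma det3_eq_0_if_same_proj: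
  assumes "same_proj u v"
  shows "det3 u v w = 0"
  using assms dot3_cross3c[of w u v] by (simp add: same_proj_def dot3_def)

lemma det3_zero [simp]: "det3 0 v w = 0"
  by (simp add: det3_expand)

lemma det3_scale: "det3 (r *s u) (s *s v) (t *s w) = r * s * t * det3 u v w"
  by (simp add: det3_expand algebra_simps)

lemma cross3c_scale: "cross3c (r *s u) (s *s v) = (r * s) *s cross3c u v"
  by (simp add: vec_eq_3 algebra_simps)

lemma same_proj_scaleE:
  assumes "same_proj u v" "u \<noteq> 0" "v \<noteq> 0"
  obtains r where "r \<noteq> 0" "v = r *s u"
proof -
  have e: "u$2 * v$3 = u$3 * v$2" "u$3 * v$1 = u$1 * v$3" "u$1 * v$2 = u$2 * v$1"
    using assms(1) by (simp_all add: same_proj_def vec_eq_3)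
  consider "u$1 \<noteq> 0" | "u$2 \<noteq> 0" | "u$3 \<noteq> 0"
    using assms(2) by (auto simp: vec_eq_3)
  then have "\<exists>r. v = r *s u"
  proof cases
    case 1
    then have "v = (v$1 / u$1) *s u" using e by (simp add: vec_eq_3 field_simps)
    then show ?thesis ..
  next
    case 2
    then have "v = (v$2 / u$2) *s u" using e by (simp add: vec_eq_3 field_simps)
    then show ?thesis ..
  next
    case 3
    then have "v = (v$3 / u$3) *s u" using e by (simp add: vec_eq_3 field_simps)
    then show ?thesis ..
  qed
  then obtain r where r: "v = r *s u" ..
  with assms(3) have "r \<noteq> 0" by auto
  with r that show ?thesis by blast
qed

text \<open>By the triple product expansion. This gives the uniqueness of the line through two
  points and, dually, of the meet of two lines.\<close>

lemma same_proj_cross3c: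
  assumes "dot3 w p = 0" "dot3 w q = 0"
  shows "same_proj (cross3c p q) w"
proof -
  have *: "cross3c (cross3c p q) w = dot3 w p *s q - dot3 w q *s p"
    by (simp add: vec_eq_3 dot3_def algebra_simps)
  show ?thesis by (simp only: same_proj_def * assms) (simp add: vec_eq_3)
qed

section \<open>Linear changes of coordinates given by a frame\<close>

definition frame_map :: "complex^3 \<Rightarrow> complex^3 \<Rightarrow> complex^3 \<Rightarrow> complex^3 \<Rightarrow> complex^3" where
  "frame_map u v w x = x$1 *s u + x$2 *s v + x$3 *s w"

lemma det3_frame_map:
  "det3 (frame_map u v w x) (frame_map u v w y) (frame_map u v w z) = det3 u v w * det3 x y z"
  by (simp add: det3_expand frame_map_def algebra_simps)

lemma cross3c_frame_map:
  "cross3c (frame_map u v w x) (frame_map u v w y) =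
    frame_map (cross3c v w) (cross3c w u) (cross3c u v) (cross3c x y)"
  by (simp add: vec_eq_3 frame_map_def algebra_simps)

text \<open>A linear map acts on cross products by its cofactor matrix, and the cofactor matrix of
  the cofactor matrix is the determinant times the original map. So a double cross product, such as
  an axis, is transported by the map itself.\<close>

lemma cross3c_cross3c_frame_map:
  "cross3c (cross3c (frame_map u v w x) (frame_map u v w y))
      (cross3c (frame_map u v w x') (frame_map u v w y')) =
    det3 u v w *s frame_map u v w (cross3c (cross3c x y) (cross3c x' y'))"
proof -
  have "cross3c (cross3c v w) (cross3c w u) = det3 u v w *s w"
       "cross3c (cross3c w u) (cross3c u v) = det3 u v w *s u"
       "cross3c (cross3c u v) (cross3c v w) = det3 u v w *s v"
    by (simp_all add: vec_eq_3 det3_expand algebra_simps)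
  then show ?thesis
    by (simp only: cross3c_frame_map) (simp add: vec_eq_3 frame_map_def algebra_simps)
qed

lemma frame_map_surj:
  assumes "det3 u v w \<noteq> 0"
  obtains x where "y = frame_map u v w x"
proof
  let ?d = "det3 u v w"
  \<comment> \<open>Cramer's rule, with denominators cleared.\<close>
  have "?d *s y = frame_map u v w (vec3 (det3 y v w) (det3 u y w) (det3 u v y))"
    by (simp add: vec_eq_3 frame_map_def det3_expand algebra_simps)
  moreover have "y = (1 / ?d) *s (?d *s y)"
    using assms by (simp add: vec_eq_3)
  ultimately have "y = (1 / ?d) *s frame_map u v w (vec3 (det3 y v w) (det3 u y w) (det3 u v y))"
    by simp
  also have "\<dots> = frame_map u v w ((1 / ?d) *s vec3 (det3 y v w) (det3 u y w) (det3 u v y))"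
    by (simp add: vec_eq_3 frame_map_def algebra_simps)
  finally show "y = frame_map u v w ((1 / ?d) *s vec3 (det3 y v w) (det3 u y w) (det3 u v y))" .
qed

lemma frame_map_scale: "frame_map u v w (r *s x) = r *s frame_map u v w x"
  by (simp add: vec_eq_3 frame_map_def algebra_simps)

section \<open>Realizations\<close>

lemma label_cases:
  assumes "k \<in> {1..8::nat}"
  shows "k = 1 \<or> k = 2 \<or> k = 3 \<or> k = 4 \<or> k = 5 \<or> k = 6 \<or> k = 7 \<or> k = 8"
  using assms by auto

lemma Spairs_bounds:
  assumes "(i, j) \<in> Spairs k"
  shows "i \<in> {1..8}" "j \<in> {1..8}" "k \<in> {1..8}" "i < j"
  using assms by (auto simp: Spairs_def split: if_splits)

lemma finite_ground [simp]: "finite ground"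
  by (simp add: ground_def)

lemma in_ground [simp]: "Ul i \<in> ground \<longleftrightarrow> i \<in> {1..8}" "Pl i \<in> ground \<longleftrightarrow> i \<in> {1..8}"
  by (auto simp: ground_def)

lemma Spairs_ground [simp]:
  assumes "(i, j) \<in> Spairs k"
  shows "Ul i \<in> ground" "Ul j \<in> ground" "Pl k \<in> ground"
  using Spairs_bounds[OF assms] by simp_all

text \<open>This is the open half of \<open>realization\<close>, stable under small perturbations;
  \<open>incidences\<close> is the closed half, settled by polynomial identities.\<close>

definition nonzero_minors :: "(lab \<Rightarrow> complex^3) \<Rightarrow> bool" where
  "nonzero_minors L \<longleftrightarrow> (\<forall>a\<in>ground. \<forall>b\<in>ground. \<forall>c\<in>ground. distinct [a, b, c] \<longrightarrow>
     \<not> nonbasis {a, b, c} \<longrightarrow> det3 (L a) (L b) (L c) \<noteq> 0)"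

definition incidences :: "(lab \<Rightarrow> complex^3) \<Rightarrow> bool" where
  "incidences L \<longleftrightarrow> (\<forall>k i j. (i, j) \<in> Spairs k \<longrightarrow> det3 (L (Ul i)) (L (Ul j)) (L (Pl k)) = 0)"

lemma not_nonbasis_Pl_Pl: "k \<noteq> l \<Longrightarrow> \<not> nonbasis {e, Pl k, Pl l}"
proof
  assume "k \<noteq> l" "nonbasis {e, Pl k, Pl l}"
  then obtain i j m where *: "{e, Pl k, Pl l} = {Ul i, Ul j, Pl m}"
    by (auto simp: nonbasis_def)
  have "Pl k \<in> {Ul i, Ul j, Pl m}" "Pl l \<in> {Ul i, Ul j, Pl m}"
    unfolding *[symmetric] by simp_all
  with \<open>k \<noteq> l\<close> show False by simp
qed

lemma not_nonbasis_Ul: "\<not> nonbasis {Ul i, Ul j, Ul k}"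
  by (auto simp: nonbasis_def)

text \<open>Three unprimed labels never form a nonbasis and two primed labels never lie in one, so
  any pair extends to a basis. Hence nonzero minors alone already force the lines to be nonzero and
  pairwise distinct.\<close>

lemma third_label:
  assumes "e \<in> ground" "e' \<in> ground" "e \<noteq> e'"
  obtains d where "d \<in> ground" "distinct [e, e', d]" "\<not> nonbasis {e, e', d}"
proof -
  have pick: "\<exists>k\<in>{1..8}. k \<noteq> i \<and> k \<noteq> j" for i j :: nat
  proof -
    have "card {i, j} < card {1..8::nat}" by (simp add: card_insert_if)
    then have "\<not> {1..8} \<subseteq> {i, j}" by (metis card_mono finite.emptyI finite.insertI leD)
    then show ?thesis by auto
  qed
  have "\<exists>d\<in>ground. d \<noteq> e \<and> d \<noteq> e' \<and> \<not> nonbasis {e, e', d}"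
  proof (cases e)
    case (Ul i)
    show ?thesis
    proof (cases e')
      case (Ul j)
      from pick[of i j] obtain k where "k \<in> {1..8}" "k \<noteq> i" "k \<noteq> j" by blast
      then show ?thesis using \<open>e = Ul i\<close> Ul not_nonbasis_Ul by (intro bexI[of _ "Ul k"]) auto
    next
      case (Pl j)
      from pick[of j j] obtain k where "k \<in> {1..8}" "k \<noteq> j" by blast
      then show ?thesis using \<open>e = Ul i\<close> Pl not_nonbasis_Pl_Pl[of j k e]
        by (intro bexI[of _ "Pl k"]) auto
    qed
  next
    case (Pl i)
    show ?thesis
    proof (cases e')
      case (Ul j)
      from pick[of i i] obtain k where "k \<in> {1..8}" "k \<noteq> i" by blast
      then show ?thesis using \<open>e = Pl i\<close> Ul not_nonbasis_Pl_Pl[of i k e']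
        by (intro bexI[of _ "Pl k"]) (auto simp: insert_commute)
    next
      case (Pl j)
      from pick[of i j] obtain k where "k \<in> {1..8}" "k \<noteq> i" "k \<noteq> j" by blast
      then show ?thesis using \<open>e = Pl i\<close> Pl not_nonbasis_Pl_Pl[of j k e]
        by (intro bexI[of _ "Pl k"]) auto
    qed
  qed
  then show ?thesis using assms(3) that by fastforce
qed

lemma nonzero_minors_imp_nonzero:
  assumes "nonzero_minors L" "e \<in> ground"
  shows "L e \<noteq> 0"
proof -
  obtain e' where "e' \<in> ground" "e \<noteq> e'"
    using in_ground by (metis atLeastAtMost_iff lab.distinct(1) one_le_numeral order_refl)
  moreover obtain d where "d \<in> ground" "distinct [e, e', d]" "\<not> nonbasis {e, e', d}"
    by (rule third_label[OF assms(2) calculation])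
  ultimately have "det3 (L e) (L e') (L d) \<noteq> 0"
    using assms unfolding nonzero_minors_def by blast
  then show ?thesis by auto
qed

lemma realization_iff: "realization L \<longleftrightarrow> incidences L \<and> nonzero_minors L"
proof
  assume L: "realization L"
  have "det3 (L (Ul i)) (L (Ul j)) (L (Pl k)) = 0" if s: "(i, j) \<in> Spairs k" for i j k
  proof -
    have "nonbasis {Ul i, Ul j, Pl k}" unfolding nonbasis_def using s by blast
    moreover have "distinct [Ul i, Ul j, Pl k]" using Spairs_bounds(4)[OF s] by simp
    moreover have "\<forall>a\<in>ground. \<forall>b\<in>ground. \<forall>c\<in>ground. distinct [a, b, c] \<longrightarrow>
        (det3 (L a) (L b) (L c) = 0 \<longleftrightarrow> nonbasis {a, b, c})"
      using L unfolding realization_def by (elim conjE)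
    ultimately show ?thesis using Spairs_ground[OF s] by metis
  qed
  moreover have "nonzero_minors L"
    using L unfolding realization_def nonzero_minors_def by metis
  ultimately show "incidences L \<and> nonzero_minors L" unfolding incidences_def by blast
next
  assume *: "incidences L \<and> nonzero_minors L"
  have zero: "det3 (L a) (L b) (L c) = 0"
    if "distinct [a, b, c]" and nb: "nonbasis {a, b, c}" for a b c
  proof -
    obtain i j k where s: "(i, j) \<in> Spairs k" and eq: "{a, b, c} = {Ul i, Ul j, Pl k}"
      using nb by (auto simp: nonbasis_def)
    have d: "det3 (L (Ul i)) (L (Ul j)) (L (Pl k)) = 0"
      using * s by (auto simp: incidences_def)
    have "a \<in> {Ul i, Ul j, Pl k}" "b \<in> {Ul i, Ul j, Pl k}" "c \<in> {Ul i, Ul j, Pl k}"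
      using eq by blast+
    moreover note det3_eq_0_perm[OF d]
    ultimately show ?thesis using that(1) d by auto
  qed
  have proj: "\<not> same_proj (L e) (L e')" if e: "e \<in> ground" "e' \<in> ground" "e \<noteq> e'" for e e'
  proof -
    obtain d where "d \<in> ground" "distinct [e, e', d]" "\<not> nonbasis {e, e', d}"
      by (rule third_label[OF e])
    with * e have "det3 (L e) (L e') (L d) \<noteq> 0" unfolding nonzero_minors_def by blast
    then show ?thesis using det3_eq_0_if_same_proj by blast
  qed
  have "L e \<noteq> 0" if "e \<in> ground" for e
    using * that nonzero_minors_imp_nonzero by blast
  with proj zero * show "realization L"
    unfolding realization_def nonzero_minors_def by metis
qed

section \<open>Invariance under projective maps and rescaling of the lines\<close>

definition proj_image ::
  "complex^3 \<Rightarrow> complex^3 \<Rightarrow> complex^3 \<Rightarrow> (lab \<Rightarrow> complex) \<Rightarrow> (lab \<Rightarrow> complex^3) \<Rightarrow>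
    (lab \<Rightarrow> complex^3) \<Rightarrow> bool" where
  "proj_image u v w s L N \<longleftrightarrow> det3 u v w \<noteq> 0 \<and>
    (\<forall>e\<in>ground. s e \<noteq> 0 \<and> L e = s e *s frame_map u v w (N e))"

lemma proj_image_invariance:
  assumes "proj_image u v w s L N"
  shows "nonzero_minors L \<longleftrightarrow> nonzero_minors N" "incidences L \<longleftrightarrow> incidences N"
    "realization L \<longleftrightarrow> realization N"
proof -
  have z: "det3 (L a) (L b) (L c) = 0 \<longleftrightarrow> det3 (N a) (N b) (N c) = 0"
    if "a \<in> ground" "b \<in> ground" "c \<in> ground" for a b c
    using assms that by (simp add: proj_image_def det3_scale det3_frame_map)
  show m: "nonzero_minors L \<longleftrightarrow> nonzero_minors N"
    unfolding nonzero_minors_def using z by auto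
  show i: "incidences L \<longleftrightarrow> incidences N"
    unfolding incidences_def using z by (metis Spairs_ground)
  show "realization L \<longleftrightarrow> realization N"
    using m i by (simp add: realization_iff)
qed

lemma frame_map_id: "frame_map (vec3 1 0 0) (vec3 0 1 0) (vec3 0 0 1) x = x"
  by (simp add: vec_eq_3 frame_map_def)

lemma scaling_invariance:
  assumes "\<And>e. e \<in> ground \<Longrightarrow> s e \<noteq> 0 \<and> L e = s e *s N e"
  shows "realization L \<longleftrightarrow> realization N"
proof (rule proj_image_invariance(3))
  show "proj_image (vec3 1 0 0) (vec3 0 1 0) (vec3 0 0 1) s L N"
    using assms by (simp add: proj_image_def frame_map_id det3_expand)
qed

section \<open>The normal form and the new lines\<close>

text \<open>The points \<open>P\<^sub>i\<close> are labelled \<open>Ul i\<close> (\<open>P\<^sub>0\<close> is \<open>Ul 8\<close>) and \<open>Q\<^sub>s\<close> is \<open>Pl k\<close> with \<open>k = 10 - s\<close> modulo 8. The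
  frame is \<open>P\<^sub>2, P\<^sub>4, Q\<^sub>2, Q\<^sub>5\<close>, and \<open>P\<^sub>7 = (1, b, c)\<close>, \<open>P\<^sub>0 = (1, 0, t b)\<close>; each of the other points is the
  intersection of two lines through known points.\<close>
definition cfg :: "complex \<Rightarrow> complex \<Rightarrow> complex \<Rightarrow> lab \<Rightarrow> complex^3" where
  "cfg t b c e = (case e of
    Ul k \<Rightarrow> [vec3 (c*(t-1)) (t*b-c) (c*(t-1)), vec3 1 0 0, vec3 1 b b, vec3 0 1 0,
      vec3 (t*b^2*(t-1)+b-c) (t*b^2*(t-1)) (t*b*(t*b-c)), vec3 0 (b-1) (c-1), vec3 1 b c,
      vec3 1 0 (t*b)] ! (k - 1)
  | Pl k \<Rightarrow> [vec3 1 (b^2) (b*c), vec3 (t*(c-1)) (c*(b-1)) (c*(c-1)),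
      vec3 (t*b-c) (b^2*(t-1)) (b*(t*b-c)), vec3 (c-1) (t*b*(1-b)) 0, vec3 1 1 1,
      vec3 (c*(b-1)) (t*b^2*(c-1)) (t*b*c*(b-1)), vec3 (t-1) (t*b-c) (c*(t-1)),
      vec3 0 0 1] ! (k - 1))"

text \<open>The quadratic relation in \<open>c\<close> that remains after the construction of
  \<open>cfg\<close>: up to the factor \<open>b\<close> it is the minor of \<open>Ul 1\<close>,
  \<open>Ul 8\<close>, \<open>Pl 1\<close>.\<close>

definition curve :: "complex \<Rightarrow> complex \<Rightarrow> complex \<Rightarrow> complex" where
  "curve t b c = c^2 - (t^2*b^2 - t*b^2 + t + b) * c + t^2*b"

lemma cfg_Ul:
  "cfg t b c (Ul 1) = vec3 (c*(t-1)) (t*b-c) (c*(t-1))"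
  "cfg t b c (Ul 2) = vec3 1 0 0"
  "cfg t b c (Ul 3) = vec3 1 b b"
  "cfg t b c (Ul 4) = vec3 0 1 0"
  "cfg t b c (Ul 5) = vec3 (t*b^2*(t-1)+b-c) (t*b^2*(t-1)) (t*b*(t*b-c))"
  "cfg t b c (Ul 6) = vec3 0 (b-1) (c-1)"
  "cfg t b c (Ul 7) = vec3 1 b c"
  "cfg t b c (Ul 8) = vec3 1 0 (t*b)"
  by (simp_all add: cfg_def)

lemma cfg_Pl:
  "cfg t b c (Pl 1) = vec3 1 (b^2) (b*c)"
  "cfg t b c (Pl 2) = vec3 (t*(c-1)) (c*(b-1)) (c*(c-1))"
  "cfg t b c (Pl 3) = vec3 (t*b-c) (b^2*(t-1)) (b*(t*b-c))"
  "cfg t b c (Pl 4) = vec3 (c-1) (t*b*(1-b)) 0"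
  "cfg t b c (Pl 5) = vec3 1 1 1"
  "cfg t b c (Pl 6) = vec3 (c*(b-1)) (t*b^2*(c-1)) (t*b*c*(b-1))"
  "cfg t b c (Pl 7) = vec3 (t-1) (t*b-c) (c*(t-1))"
  "cfg t b c (Pl 8) = vec3 0 0 1"
  by (simp_all add: cfg_def)

text \<open>The line through \<open>S\<^sub>k\<close>, computed from the first two points of \<open>S\<^sub>k\<close>.\<close>
definition axis :: "(lab \<Rightarrow> complex^3) \<Rightarrow> nat \<Rightarrow> complex^3" where
  "axis L k = (let q = (\<lambda>i j. cross3c (L (Pl i)) (L (Pl j))) in
    [cross3c (q 1 8) (q 2 7), cross3c (q 1 7) (q 2 6), cross3c (q 1 6) (q 2 5),
     cross3c (q 1 5) (q 2 4), cross3c (q 1 4) (q 2 3), cross3c (q 1 3) (q 4 8),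
     cross3c (q 1 2) (q 3 8), cross3c (q 2 8) (q 3 7)] ! (k - 1))"

text \<open>The candidate for the new arrangement: the primed lines move to the unprimed labels and
  their computed axes become the primed lines. \<open>Lambda_axis\<close> relates these axes to
  \<open>Lambda\<close>.\<close>

definition ext :: "(lab \<Rightarrow> complex^3) \<Rightarrow> lab \<Rightarrow> complex^3" where
  "ext L e = (case e of Ul k \<Rightarrow> L (Pl k) | Pl k \<Rightarrow> axis L k)"

lemma ext_simps [simp]: "ext L (Ul k) = L (Pl k)" "ext L (Pl k) = axis L k"
  by (simp_all add: ext_def)

lemma axis_numeral:
  "axis L 1 = cross3c (cross3c (L (Pl 1)) (L (Pl 8))) (cross3c (L (Pl 2)) (L (Pl 7)))"
  "axis L 2 = cross3c (cross3c (L (Pl 1)) (L (Pl 7))) (cross3c (L (Pl 2)) (L (Pl 6)))"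
  "axis L 3 = cross3c (cross3c (L (Pl 1)) (L (Pl 6))) (cross3c (L (Pl 2)) (L (Pl 5)))"
  "axis L 4 = cross3c (cross3c (L (Pl 1)) (L (Pl 5))) (cross3c (L (Pl 2)) (L (Pl 4)))"
  "axis L 5 = cross3c (cross3c (L (Pl 1)) (L (Pl 4))) (cross3c (L (Pl 2)) (L (Pl 3)))"
  "axis L 6 = cross3c (cross3c (L (Pl 1)) (L (Pl 3))) (cross3c (L (Pl 4)) (L (Pl 8)))"
  "axis L 7 = cross3c (cross3c (L (Pl 1)) (L (Pl 2))) (cross3c (L (Pl 3)) (L (Pl 8)))"
  "axis L 8 = cross3c (cross3c (L (Pl 2)) (L (Pl 8))) (cross3c (L (Pl 3)) (L (Pl 7)))"
  by (simp_all add: axis_def)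

lemma cross3c_vec3: "cross3c (vec3 x y z) (vec3 x' y' z') =
    vec3 (y * z' - z * y') (z * x' - x * z') (x * y' - y * x')"
  by (simp add: vec_eq_3)

lemma det3_vec3: "det3 (vec3 x y z) (vec3 x' y' z') (vec3 x'' y'' z'') =
    x * (y' * z'' - z' * y'') + y * (z' * x'' - x' * z'') + z * (x' * y'' - y' * x'')"
  by (simp add: det3_expand)

text \<open>Of the 28 prescribed incidences these seven hold only on the curve, with explicit
  cofactors; the other 21 minors vanish identically in \<open>t\<close>, \<open>b\<close>,
  \<open>c\<close>.\<close>

lemma cfg_minors:
  "det3 (cfg t b c (Ul 1)) (cfg t b c (Ul 8)) (cfg t b c (Pl 1)) = b * curve t b c"
  "det3 (cfg t b c (Ul 4)) (cfg t b c (Ul 5)) (cfg t b c (Pl 1)) = b * curve t b c"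
  "det3 (cfg t b c (Ul 3)) (cfg t b c (Ul 5)) (cfg t b c (Pl 2)) = (b*c - b^2) * curve t b c"
  "det3 (cfg t b c (Ul 1)) (cfg t b c (Ul 6)) (cfg t b c (Pl 3)) = (c - b) * curve t b c"
  "det3 (cfg t b c (Ul 1)) (cfg t b c (Ul 5)) (cfg t b c (Pl 4)) = (t*b*c - t*b^2) * curve t b c"
  "det3 (cfg t b c (Ul 5)) (cfg t b c (Ul 7)) (cfg t b c (Pl 6)) = (t*b^2*c - t*b^3) * curve t b c"
  "det3 (cfg t b c (Ul 5)) (cfg t b c (Ul 6)) (cfg t b c (Pl 7)) = (b - c) * curve t b c"
  unfolding cfg_Ul cfg_Pl det3_vec3 curve_def by algebra+

text \<open>Two points of each S_k lie on its axis by construction, which accounts for 16 of the 28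
  incidences. These are the other 12; the cofactors are the quotients of the minors by
  \<open>curve\<close>, and the one for axis 6 vanishes identically.\<close>

lemma ext_cfg_minors:
  "det3 (cfg t b c (Pl 3)) (cfg t b c (Pl 6)) (axis (cfg t b c) 1) =
    (-(t^2*b^4*c) + t^2*b^4 + t^2*b^3*c^2 - t^2*b^3*c + t*b^4*c - 2*t*b^3*c - t*b^2*c^3 +
      2*t*b^2*c^2 - b^4*c + b^3*c^2 + b^3*c - b^2*c^2) * curve t b c"
  "det3 (cfg t b c (Pl 4)) (cfg t b c (Pl 5)) (axis (cfg t b c) 1) =
    (t*b^2*c - t*b^2 - t*b*c + t*b - b^2*c + b^2 + c^2 - c) * curve t b c"
  "det3 (cfg t b c (Pl 3)) (cfg t b c (Pl 5)) (axis (cfg t b c) 2) =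
    (t*b^5*c - 2*t*b^4*c^2 - 2*t*b^4*c + t*b^3*c^3 + 4*t*b^3*c^2 + t*b^3*c - 2*t*b^2*c^3 -
      2*t*b^2*c^2 + t*b*c^3 - b^4*c^2 + b^4*c + 2*b^3*c^3 - b^3*c^2 - b^3*c - b^2*c^4 -
      b^2*c^3 + 2*b^2*c^2 + b*c^4 - b*c^3) * curve t b c"
  "det3 (cfg t b c (Pl 3)) (cfg t b c (Pl 4)) (axis (cfg t b c) 3) =
    (-(t^2*b^5*c) + t^2*b^5 + t^2*b^4*c^2 - t^2*b^4 - t^2*b^3*c^2 + t^2*b^3*c + t*b^5*c^2 -
      2*t*b^5*c - t*b^4*c^3 + 2*t*b^4*c^2 + 2*t*b^4*c - 3*t*b^3*c^2 + t*b^2*c^3) * curve t b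
      c"
  "det3 (cfg t b c (Pl 7)) (cfg t b c (Pl 8)) (axis (cfg t b c) 3) =
    (-(t*b^2*c) + t*b^2 + t*b*c^2 - t*b*c + b^3*c - b^2*c^2 - b^2*c + b*c^2) * curve t b c"
  "det3 (cfg t b c (Pl 6)) (cfg t b c (Pl 8)) (axis (cfg t b c) 4) =
    (t*b^3*c^2 - 2*t*b^3*c + t*b^3 - t*b^2*c^2 + 2*t*b^2*c - t*b^2 + b^3*c^2 - b^3*c -
      2*b^2*c^2 + 2*b^2*c + b*c^2 - b*c) * curve t b c"
  "det3 (cfg t b c (Pl 5)) (cfg t b c (Pl 8)) (axis (cfg t b c) 5) =
    (-(t*b^3*c) + t*b^3 + t*b^2*c - t*b^2 + b^3*c - b^3 - b*c^2 + b*c) * curve t b c"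
  "det3 (cfg t b c (Pl 6)) (cfg t b c (Pl 7)) (axis (cfg t b c) 5) =
    (-(2*t^2*b^5*c^2) + 2*t^2*b^5*c + 3*t^2*b^4*c^3 - 2*t^2*b^4*c^2 - t^2*b^4*c - t^2*b^3*c^4
      + t^2*b^3*c^2 + t*b^5*c^2 - t*b^5*c - t*b^3*c^4 - t*b^3*c^3 + 2*t*b^3*c^2 + 2*t*b^2*c^4
      - 2*t*b^2*c^3 - b^4*c^3 + b^4*c^2 + b^3*c^4 - b^3*c^2 - b^2*c^4 + b^2*c^3) * curve t b
      c"
  "det3 (cfg t b c (Pl 5)) (cfg t b c (Pl 7)) (axis (cfg t b c) 6) = 0"
  "det3 (cfg t b c (Pl 4)) (cfg t b c (Pl 7)) (axis (cfg t b c) 7) =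
    (-(t*b^3*c) + t*b^2*c^2 + t*b^2*c - t*b*c^2 + b^2*c^2 - b^2*c - b*c^3 + b*c^2) * curve t b c"
  "det3 (cfg t b c (Pl 5)) (cfg t b c (Pl 6)) (axis (cfg t b c) 7) =
    (-(t*b^4*c) + t*b^4 + t*b^3*c^2 - t*b^3*c + b^3*c - b^2*c^2 - b^2*c + b*c^2) * curve t b c"
  "det3 (cfg t b c (Pl 4)) (cfg t b c (Pl 6)) (axis (cfg t b c) 8) =
    (-(t^2*b^4*c) + t^2*b^4 + 2*t^2*b^3*c^2 - 2*t^2*b^3*c - t^2*b^2*c^3 + t^2*b^2*c^2 -
      t*b^4*c + 2*t*b^3*c^2 + t*b^3*c - t*b^2*c^3 - 2*t*b^2*c^2 + t*b*c^3) * curve t b c"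
  unfolding axis_numeral cfg_Pl cross3c_vec3 det3_vec3 curve_def by algebra+

lemma incidences_cfg:
  assumes "curve t b c = 0"
  shows "incidences (cfg t b c)"
  unfolding incidences_def
proof (intro allI impI)
  fix k i j assume s: "(i, j) \<in> Spairs k"
  note m = cfg_minors[of t b c, unfolded assms mult_zero_right]
  from s show "det3 (cfg t b c (Ul i)) (cfg t b c (Ul j)) (cfg t b c (Pl k)) = 0"
    unfolding Spairs_def
    by (auto simp only: m split: if_splits) (simp only: cfg_Ul cfg_Pl det3_vec3, simp add: algebra_simps power2_eq_square)+
qed

lemma det3_cross3c_cross3c:
  "det3 u v (cross3c (cross3c u v) w) = 0" "det3 u v (cross3c w (cross3c u v)) = 0"
  by (simp_all add: det3_expand algebra_simps)

lemma incidences_ext_cfg: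
  assumes "curve t b c = 0"
  shows "incidences (ext (cfg t b c))"
  unfolding incidences_def ext_simps
proof (intro allI impI)
  fix k i j assume s: "(i, j) \<in> Spairs k"
  note m = ext_cfg_minors[of t b c, unfolded assms mult_zero_right]
  from s show "det3 (cfg t b c (Pl i)) (cfg t b c (Pl j)) (axis (cfg t b c) k) = 0"
    unfolding Spairs_def
    by (auto simp only: m split: if_splits) (simp_all only: axis_numeral det3_cross3c_cross3c)
qed

lemma axis_proj_image:
  assumes L: "proj_image u v w s L N" and k: "k \<in> {1..8}"
  shows "\<exists>r. r \<noteq> 0 \<and> axis L k = r *s frame_map u v w (axis N k)"
proof -
  let ?q = "\<lambda>L i j. cross3c (L (Pl i)) (L (Pl j))"
  \<comment> \<open>The factor collects the scalings of the four lines and the determinant from the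
    double cofactor matrix.\<close>
  have *: "\<exists>r. r \<noteq> 0 \<and> cross3c (?q L i j) (?q L g h) = r *s frame_map u v w (cross3c (?q N i j) (?q N g h))"
    if "i \<in> {1..8}" "j \<in> {1..8}" "g \<in> {1..8}" "h \<in> {1..8}" for i j g h
    using that L
    by (intro exI[of _ "s (Pl i) * s (Pl j) * (s (Pl g) * s (Pl h)) * det3 u v w"])
       (simp add: proj_image_def cross3c_scale cross3c_cross3c_frame_map)
  show ?thesis
    using label_cases[OF k] by (elim disjE; simp only: axis_numeral; intro *; simp)
qed

lemma ext_proj_image:
  assumes L: "proj_image u v w s L N"
  obtains r where "proj_image u v w r (ext L) (ext N)"
proof -
  have "\<exists>r. r \<noteq> 0 \<and> ext L e = r *s frame_map u v w (ext N e)" if "e \<in> ground" for e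
  proof (cases e)
    case (Ul i)
    with that L show ?thesis by (auto simp: proj_image_def)
  next
    case (Pl i)
    with that show ?thesis using axis_proj_image[OF L] by auto
  qed
  then obtain r where "\<forall>e\<in>ground. r e \<noteq> 0 \<and> ext L e = r e *s frame_map u v w (ext N e)"
    by metis
  with L that show ?thesis unfolding proj_image_def by blast
qed

section \<open>Reduction to the normal form\<close>

lemma realization_det3:
  assumes "realization X" "p \<in> ground" "q \<in> ground" "r \<in> ground" "distinct [p, q, r]"
  shows "det3 (X p) (X q) (X r) = 0 \<longleftrightarrow> nonbasis {p, q, r}"
  using assms unfolding realization_def by auto

definition propto :: "complex^3 \<Rightarrow> complex^3 \<Rightarrow> bool" where
  "propto x y \<longleftrightarrow> (\<exists>r. r \<noteq> 0 \<and> x = r *s y)"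

text \<open>In the dual picture \<open>X e\<close> lies on the line through \<open>p\<close>,
  \<open>q\<close> and on the line through \<open>r\<close>, \<open>s\<close>. These lines differ
  because \<open>p\<close>, \<open>q\<close>, \<open>r\<close> are independent, so
  \<open>X e\<close> is their meet. The scalar \<open>k\<close> strips a common factor off the
  computed coordinates.\<close>

lemma propto_meet:
  assumes X: "realization X"
    and g: "e \<in> ground" "p \<in> ground" "q \<in> ground" "r \<in> ground" "s \<in> ground"
    and d: "distinct [p, q, r]" "distinct [p, q, e]" "distinct [r, s, e]"
    and nb: "nonbasis {p, q, e}" "nonbasis {r, s, e}" "\<not> nonbasis {p, q, r}"
    and P: "propto (X p) P" "propto (X q) Q" "propto (X r) R" "propto (X s) S"
    and N: "cross3c (cross3c P Q) (cross3c R S) = k *s N"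
  shows "propto (X e) N"
proof -
  from P obtain x y z w where
    eq: "X p = x *s P" "X q = y *s Q" "X r = z *s R" "X s = w *s S"
    by (auto simp: propto_def)
  let ?v = "cross3c (cross3c (X p) (X q)) (cross3c (X r) (X s))"
  have dep: "det3 (X p) (X q) (X e) = 0" "det3 (X r) (X s) (X e) = 0"
    and indep: "det3 (X p) (X q) (X r) \<noteq> 0" "\<not> same_proj (X r) (X s)" "X e \<noteq> 0"
    using X g d nb unfolding realization_def by auto
  \<comment> \<open>Expand the meet in terms of \<open>X r\<close> and \<open>X s\<close>; crossing
    with \<open>X r\<close> kills one term and leaves a nonzero vector, which shows that
    \<open>?v\<close> is not zero.\<close>
  have "?v = det3 (X p) (X q) (X s) *s X r - det3 (X p) (X q) (X r) *s X s"
    by (simp add: vec_eq_3 det3_expand algebra_simps)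
  moreover have "cross3c (X r) (a *s X r - b *s X s) = - b *s cross3c (X r) (X s)" for a b
    by (simp add: vec_eq_3 algebra_simps)
  ultimately have "cross3c (X r) ?v = - det3 (X p) (X q) (X r) *s cross3c (X r) (X s)"
    by simp
  moreover have "cross3c (X r) 0 = 0"
    by (simp add: vec_eq_3)
  ultimately have "?v \<noteq> 0"
    using indep(1,2) unfolding same_proj_def by (metis neg_equal_0_iff_equal vector_mul_eq_0)
  moreover have "same_proj ?v (X e)"
    by (rule same_proj_cross3c) (simp_all add: dot3_cross3c dep)
  ultimately obtain t where t: "X e = t *s ?v"
    using indep(3) by (metis same_proj_scaleE)
  have "X e = (t * (x * y * (z * w)) * k) *s N"
    using N by (simp add: t eq cross3c_scale vector_smult_assoc)
  then show ?thesis
    using indep(3) unfolding propto_def by (metis vector_smult_lzero)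
qed

lemma nonbasis_Ul_Ul_Pl: "nonbasis {Ul i, Ul j, Pl k} \<longleftrightarrow> (i, j) \<in> Spairs k \<or> (j, i) \<in> Spairs k"
proof
  assume "nonbasis {Ul i, Ul j, Pl k}"
  then obtain i' j' k' where s: "(i', j') \<in> Spairs k'" and eq: "{Ul i, Ul j, Pl k} = {Ul i', Ul j', Pl k'}"
    by (auto simp: nonbasis_def)
  have "Pl k \<in> {Ul i', Ul j', Pl k'}" "Ul i \<in> {Ul i', Ul j', Pl k'}" "Ul j \<in> {Ul i', Ul j', Pl k'}"
    "Ul i' \<in> {Ul i, Ul j, Pl k}" "Ul j' \<in> {Ul i, Ul j, Pl k}"
    using eq by blast+
  then show "(i, j) \<in> Spairs k \<or> (j, i) \<in> Spairs k"
    using s Spairs_bounds(4)[OF s] by auto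
next
  assume "(i, j) \<in> Spairs k \<or> (j, i) \<in> Spairs k"
  then show "nonbasis {Ul i, Ul j, Pl k}"
    unfolding nonbasis_def by (metis insert_commute)
qed

lemma nonbasis_perm: "nonbasis {Ul i, Pl k, Ul j} \<longleftrightarrow> nonbasis {Ul i, Ul j, Pl k}"
  "nonbasis {Pl k, Ul i, Ul j} \<longleftrightarrow> nonbasis {Ul i, Ul j, Pl k}"
  "k \<noteq> l \<Longrightarrow> \<not> nonbasis {Pl k, e, Pl l}"
  using not_nonbasis_Pl_Pl[of k l e] by (simp_all add: insert_commute)

lemmas nonbasis_simps = nonbasis_Ul_Ul_Pl nonbasis_perm not_nonbasis_Ul not_nonbasis_Pl_Pl

lemma propto_coords:
  assumes "x$1 \<noteq> 0"
  shows "propto x (vec3 1 (x$2 / x$1) (x$3 / x$1))"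
  unfolding propto_def using assms
  by (intro exI[of _ "x$1"]) (simp add: vec_eq_3)

lemma normal_form_in_frame:
  assumes X: "realization X"
    and frame: "propto (X (Ul 2)) (vec3 1 0 0)" "propto (X (Ul 4)) (vec3 0 1 0)"
      "propto (X (Pl 8)) (vec3 0 0 1)" "propto (X (Pl 5)) (vec3 1 1 1)"
  shows "\<exists>t b c. curve t b c = 0 \<and> (\<forall>e\<in>ground. propto (X e) (cfg t b c e))"
proof -
  from frame(1-3) obtain x y z
    where e: "X (Ul 2) = x *s vec3 1 0 0" "X (Ul 4) = y *s vec3 0 1 0" "X (Pl 8) = z *s vec3 0 0 1"
    unfolding propto_def by metis
  note mi = realization_det3[OF X]
  \<comment> \<open>\<open>b\<close> and \<open>c\<close> are the affine coordinates of
    \<open>Ul 7\<close>; \<open>t\<close> is scaled so that \<open>Ul 8\<close> becomes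
    \<open>(1, 0, t b)\<close>.\<close>
  define b c t where "b = X (Ul 7) $ 2 / X (Ul 7) $ 1" and "c = X (Ul 7) $ 3 / X (Ul 7) $ 1"
    and "t = X (Ul 8) $ 3 / X (Ul 8) $ 1 / b"
  \<comment> \<open>Against two frame vectors a determinant is a single coordinate up to a nonzero
    factor. The three bases make the divisions by first coordinates and by \<open>b\<close>
    legitimate; the nonbasis puts \<open>Ul 8\<close> on the line through \<open>Ul 2\<close> and
    \<open>Pl 8\<close>.\<close>
  have "det3 (X (Ul 8)) (X (Ul 4)) (X (Pl 8)) \<noteq> 0" "det3 (X (Ul 7)) (X (Ul 4)) (X (Pl 8)) \<noteq> 0"
    "det3 (X (Ul 2)) (X (Ul 7)) (X (Pl 8)) \<noteq> 0" "det3 (X (Ul 2)) (X (Ul 8)) (X (Pl 8)) = 0"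
    by (subst mi; simp add: nonbasis_simps Spairs_def)+
  then have nz: "X (Ul 8) $ 1 \<noteq> 0" "X (Ul 7) $ 1 \<noteq> 0" "X (Ul 7) $ 2 \<noteq> 0" and 0: "X (Ul 8) $ 2 = 0"
    by (auto simp: e det3_expand)
  then have b: "b \<noteq> 0" and X8: "X (Ul 8) $ 3 / X (Ul 8) $ 1 = t * b"
    by (simp_all add: b_def t_def)
  note meet = propto_meet[OF X]
  have U2: "propto (X (Ul 2)) (cfg t b c (Ul 2))" and U4: "propto (X (Ul 4)) (cfg t b c (Ul 4))"
    and P8: "propto (X (Pl 8)) (cfg t b c (Pl 8))" and P5: "propto (X (Pl 5)) (cfg t b c (Pl 5))"
    using frame by (simp_all only: cfg_Ul cfg_Pl)
  have U7: "propto (X (Ul 7)) (cfg t b c (Ul 7))"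
    using propto_coords[OF nz(2)] by (simp only: cfg_Ul b_def c_def)
  have U8: "propto (X (Ul 8)) (cfg t b c (Ul 8))"
    using propto_coords[OF nz(1)] by (simp only: cfg_Ul X8 0) simp
  \<comment> \<open>Here and below, the new point is the meet of the line through the first two
    cited points with the line through the last two; \<open>k\<close> is the factor by which the
    cross product exceeds the coordinates in \<open>cfg\<close>.\<close>
  have U3: "propto (X (Ul 3)) (cfg t b c (Ul 3))"
    by (rule meet[OF _ _ _ _ _ _ _ _ _ _ _ U2 P5 U7 P8, where k="1"])
      (simp_all add: nonbasis_simps Spairs_def del: One_nat_def,
       (simp only: cfg_Ul cfg_Pl cross3c_vec3, simp add: vec_eq_3 algebra_simps power2_eq_square)?)
  have U6: "propto (X (Ul 6)) (cfg t b c (Ul 6))"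
    by (rule meet[OF _ _ _ _ _ _ _ _ _ _ _ U4 P8 U7 P5, where k="1"])
      (simp_all add: nonbasis_simps Spairs_def del: One_nat_def,
       (simp only: cfg_Ul cfg_Pl cross3c_vec3, simp add: vec_eq_3 algebra_simps power2_eq_square)?)
  have P1: "propto (X (Pl 1)) (cfg t b c (Pl 1))"
    by (rule meet[OF _ _ _ _ _ _ _ _ _ _ _ U2 U7 U3 U6, where k="c - b"])
      (simp_all add: nonbasis_simps Spairs_def del: One_nat_def,
       (simp only: cfg_Ul cfg_Pl cross3c_vec3, simp add: vec_eq_3 algebra_simps power2_eq_square)?)
  have P7: "propto (X (Pl 7)) (cfg t b c (Pl 7))"
    by (rule meet[OF _ _ _ _ _ _ _ _ _ _ _ U3 U8 U4 U7, where k="b"])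
      (simp_all add: nonbasis_simps Spairs_def del: One_nat_def,
       (simp only: cfg_Ul cfg_Pl cross3c_vec3, simp add: vec_eq_3 algebra_simps power2_eq_square)?)
  have P4: "propto (X (Pl 4)) (cfg t b c (Pl 4))"
    by (rule meet[OF _ _ _ _ _ _ _ _ _ _ _ U2 U4 U6 U8, where k="-1"])
      (simp_all add: nonbasis_simps Spairs_def del: One_nat_def,
       (simp only: cfg_Ul cfg_Pl cross3c_vec3, simp add: vec_eq_3 algebra_simps power2_eq_square)?)
  have P3: "propto (X (Pl 3)) (cfg t b c (Pl 3))"
    by (rule meet[OF _ _ _ _ _ _ _ _ _ _ _ U7 U8 U3 U4, where k="-1"])
      (simp_all add: nonbasis_simps Spairs_def del: One_nat_def,
       (simp only: cfg_Ul cfg_Pl cross3c_vec3, simp add: vec_eq_3 algebra_simps power2_eq_square)?)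
  have U1: "propto (X (Ul 1)) (cfg t b c (Ul 1))"
    by (rule meet[OF _ _ _ _ _ _ _ _ _ _ _ U4 P5 U2 P7, where k="-1"])
      (simp_all add: nonbasis_simps Spairs_def del: One_nat_def,
       (simp only: cfg_Ul cfg_Pl cross3c_vec3, simp add: vec_eq_3 algebra_simps power2_eq_square)?)
  have P2: "propto (X (Pl 2)) (cfg t b c (Pl 2))"
    by (rule meet[OF _ _ _ _ _ _ _ _ _ _ _ U1 U7 U2 U6, where k="c - b"])
      (simp_all add: nonbasis_simps Spairs_def del: One_nat_def,
       (simp only: cfg_Ul cfg_Pl cross3c_vec3, simp add: vec_eq_3 algebra_simps power2_eq_square)?)
  have U5: "propto (X (Ul 5)) (cfg t b c (Ul 5))"
    by (rule meet[OF _ _ _ _ _ _ _ _ _ _ _ U8 P5 U2 P3, where k="b"])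
      (simp_all add: nonbasis_simps Spairs_def del: One_nat_def,
       (simp only: cfg_Ul cfg_Pl cross3c_vec3, simp add: vec_eq_3 algebra_simps power2_eq_square)?)
  have P6: "propto (X (Pl 6)) (cfg t b c (Pl 6))"
    by (rule meet[OF _ _ _ _ _ _ _ _ _ _ _ U4 U8 U1 U3, where k="1 - t"])
      (simp_all add: nonbasis_simps Spairs_def del: One_nat_def,
       (simp only: cfg_Ul cfg_Pl cross3c_vec3, simp add: vec_eq_3 algebra_simps power2_eq_square)?)
  have all: "propto (X e) (cfg t b c e)" if e: "e \<in> ground" for e
  proof (cases e)
    case (Ul k)
    then have "k \<in> {1..8}" using e by simp
    from label_cases[OF this] show ?thesis
      unfolding Ul using U1 U2 U3 U4 U5 U6 U7 U8 by blast
  next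
    case (Pl k)
    then have "k \<in> {1..8}" using e by simp
    from label_cases[OF this] show ?thesis
      unfolding Pl using P1 P2 P3 P4 P5 P6 P7 P8 by blast
  qed
  \<comment> \<open>This incidence was not spent on the construction; since \<open>b\<close> is
    nonzero, it forces the point onto the curve.\<close>
  have "det3 (X (Ul 1)) (X (Ul 8)) (X (Pl 1)) = 0"
    by (subst mi) (simp_all add: nonbasis_simps Spairs_def)
  with U1 U8 P1 have "det3 (cfg t b c (Ul 1)) (cfg t b c (Ul 8)) (cfg t b c (Pl 1)) = 0"
    by (auto simp: propto_def det3_scale)
  then have "curve t b c = 0"
    using b by (simp only: cfg_minors mult_eq_0_iff neg_equal_0_iff_equal simp_thms)
  then show ?thesis using all by blast
qed

lemma det3_frame_map_nth:
  "det3 (frame_map u v w x) v w = x$1 * det3 u v w"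
  "det3 u (frame_map u v w x) w = x$2 * det3 u v w"
  "det3 u v (frame_map u v w x) = x$3 * det3 u v w"
  by (simp_all add: frame_map_def det3_expand algebra_simps)

lemma normal_form:
  assumes L: "realization L"
  obtains u v w s t b c where "curve t b c = 0" "proj_image u v w s L (cfg t b c)"
proof -
  let ?p = "L (Ul 2)" and ?q = "L (Ul 4)" and ?r = "L (Pl 8)" and ?y = "L (Pl 5)"
  note mi = realization_det3[OF L]
  have d: "det3 ?p ?q ?r \<noteq> 0"
    by (subst mi) (simp_all add: nonbasis_simps Spairs_def)
  have d': "det3 ?y ?q ?r \<noteq> 0" "det3 ?p ?y ?r \<noteq> 0" "det3 ?p ?q ?y \<noteq> 0"
    by (subst mi; simp add: nonbasis_simps Spairs_def)+
  obtain y where y: "?y = frame_map ?p ?q ?r y"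
    by (rule frame_map_surj[OF d])
  have y0: "y$1 \<noteq> 0" "y$2 \<noteq> 0" "y$3 \<noteq> 0"
    using d' unfolding y by (auto simp: det3_frame_map_nth)
  \<comment> \<open>Rescaling the three frame vectors by the coordinates of \<open>?y\<close> turns
    \<open>?y\<close> into the unit point \<open>(1, 1, 1)\<close>.\<close>
  define u v w where "u = y$1 *s ?p" and "v = y$2 *s ?q" and "w = y$3 *s ?r"
  have uvw: "det3 u v w \<noteq> 0"
    using y0 d by (simp add: u_def v_def w_def det3_scale)
  have "\<exists>x. L e = frame_map u v w x" for e
    by (rule frame_map_surj[OF uvw]) blast
  then obtain X where X: "\<And>e. L e = frame_map u v w (X e)"
    by metis
  have inj: "x = x'" if "frame_map u v w x = frame_map u v w x'" for x x'
    using det3_frame_map_nth[of u v w x] det3_frame_map_nth[of u v w x'] that uvw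
    by (simp add: vec_eq_3)
  have rX: "realization X"
    using proj_image_invariance(3)[of u v w "\<lambda>_. 1" L X] X L uvw by (simp add: proj_image_def)
  have "frame_map u v w (X (Ul 2)) = frame_map u v w ((1 / y$1) *s vec3 1 0 0)"
    "frame_map u v w (X (Ul 4)) = frame_map u v w ((1 / y$2) *s vec3 0 1 0)"
    "frame_map u v w (X (Pl 8)) = frame_map u v w ((1 / y$3) *s vec3 0 0 1)"
    "frame_map u v w (X (Pl 5)) = frame_map u v w (1 *s vec3 1 1 1)"
    using y0 unfolding X[symmetric] y
    by (simp_all add: frame_map_def u_def v_def w_def vec_eq_3)
  then have "X (Ul 2) = (1 / y$1) *s vec3 1 0 0" "X (Ul 4) = (1 / y$2) *s vec3 0 1 0"
    "X (Pl 8) = (1 / y$3) *s vec3 0 0 1" "X (Pl 5) = 1 *s vec3 1 1 1"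
    using inj by blast+
  then have "propto (X (Ul 2)) (vec3 1 0 0)" "propto (X (Ul 4)) (vec3 0 1 0)"
      "propto (X (Pl 8)) (vec3 0 0 1)" "propto (X (Pl 5)) (vec3 1 1 1)"
    unfolding propto_def using y0 by (metis divide_eq_0_iff zero_neq_one)+
  then obtain t b c where tbc: "curve t b c = 0" "\<And>e. e \<in> ground \<Longrightarrow> propto (X e) (cfg t b c e)"
    using normal_form_in_frame[OF rX] by blast
  from tbc(2) obtain s where "\<And>e. e \<in> ground \<Longrightarrow> s e \<noteq> 0 \<and> X e = s e *s cfg t b c e"
    unfolding propto_def by metis
  then have "proj_image u v w s L (cfg t b c)"
    using X uvw by (simp add: proj_image_def frame_map_scale)
  with tbc(1) that show ?thesis by blast
qed

section \<open>Minors along a line in the parameter plane\<close>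

text \<open>Such \<open>g\<close> represent elements of the ring obtained from \<complex>[x] by
  adjoining a root \<open>c\<close> of a monic quadratic: reduction leaves degree at most one in
  \<open>c\<close>. Closure under ring operations makes every minor of the family of this
  kind.\<close>

definition affine_on :: "complex poly \<Rightarrow> complex poly \<Rightarrow> (complex \<Rightarrow> complex \<Rightarrow> complex) \<Rightarrow> bool" where
  "affine_on m n g \<longleftrightarrow>
    (\<exists>p q. \<forall>x c. c^2 = poly m x * c - poly n x \<longrightarrow> g x c = poly p x + poly q x * c)"

lemma affine_on_poly: "affine_on m n (\<lambda>x c. poly p x)"
  unfolding affine_on_def by (rule exI[of _ p], rule exI[of _ 0]) simp

lemma affine_on_const: "affine_on m n (\<lambda>x c. a)"
  using affine_on_poly[of m n "[:a:]"] by simp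

lemma affine_on_var: "affine_on m n (\<lambda>x c. c)"
  unfolding affine_on_def by (rule exI[of _ 0], rule exI[of _ 1]) simp

lemma affine_on_add:
  assumes "affine_on m n f" "affine_on m n g"
  shows "affine_on m n (\<lambda>x c. f x c + g x c)"
proof -
  from assms obtain p q p' q' where
    "\<And>x c. c^2 = poly m x * c - poly n x \<Longrightarrow> f x c = poly p x + poly q x * c"
    "\<And>x c. c^2 = poly m x * c - poly n x \<Longrightarrow> g x c = poly p' x + poly q' x * c"
    unfolding affine_on_def by metis
  then show ?thesis
    unfolding affine_on_def
    by (intro exI[of _ "p + p'"] exI[of _ "q + q'"]) (simp add: algebra_simps)
qed

lemma affine_on_mult:
  assumes "affine_on m n f" "affine_on m n g"
  shows "affine_on m n (\<lambda>x c. f x c * g x c)"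
proof -
  from assms obtain p q p' q' where
    f: "\<And>x c. c^2 = poly m x * c - poly n x \<Longrightarrow> f x c = poly p x + poly q x * c" and
    g: "\<And>x c. c^2 = poly m x * c - poly n x \<Longrightarrow> g x c = poly p' x + poly q' x * c"
    unfolding affine_on_def by metis
  have "f x c * g x c = poly (p * p' - q * q' * n) x + poly (p * q' + p' * q + q * q' * m) x * c"
    if c: "c^2 = poly m x * c - poly n x" for x c
  proof -
    have "f x c * g x c = poly p x * poly p' x + (poly p x * poly q' x + poly p' x * poly q x) * c
        + poly q x * poly q' x * c^2"
      unfolding f[OF c] g[OF c] by (simp add: algebra_simps power2_eq_square)
    then show ?thesis unfolding c by (simp add: algebra_simps)
  qed
  then show ?thesis unfolding affine_on_def by blast
qed

lemma affine_on_diff: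
  assumes "affine_on m n f" "affine_on m n g"
  shows "affine_on m n (\<lambda>x c. f x c - g x c)"
  using affine_on_add[OF assms(1) affine_on_mult[OF affine_on_const[of m n "-1"] assms(2)]] by simp

lemma affine_on_power: "affine_on m n f \<Longrightarrow> affine_on m n (\<lambda>x c. f x c ^ k)"
  by (induction k) (simp_all add: affine_on_const affine_on_mult)

lemmas affine_on_intros = affine_on_add affine_on_diff affine_on_mult affine_on_power affine_on_var
  affine_on_poly affine_on_const

lemma quadratic_roots:
  fixes m n :: complex
  obtains r s where "m = r + s" "n = r * s"
proof
  let ?d = "csqrt (m^2 - 4 * n)"
  show "m = (m + ?d) / 2 + (m - ?d) / 2" by (simp add: field_simps)
  have "((m + ?d) / 2) * ((m - ?d) / 2) = (m^2 - ?d^2) / 4"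
    by (simp add: field_simps power2_eq_square)
  then show "n = ((m + ?d) / 2) * ((m - ?d) / 2)" by simp
qed

text \<open>The norm of \<open>p + q c\<close> over \<open>\<complex>(x)\<close> is a polynomial in \<open>x\<close>, so it has finitely many zeros.\<close>
lemma affine_on_finite_zeros:
  assumes g: "affine_on m n g"
    and a: "\<And>c. c^2 = poly m a * c - poly n a \<Longrightarrow> g a c \<noteq> 0"
  shows "finite {x. \<exists>c. c^2 = poly m x * c - poly n x \<and> g x c = 0}"
proof -
  from g obtain p q where
    pq: "\<And>x c. c^2 = poly m x * c - poly n x \<Longrightarrow> g x c = poly p x + poly q x * c"
    unfolding affine_on_def by metis
  define N where "N = p^2 + p * q * m + q^2 * n"
  obtain r s where rs: "poly m a = r + s" "poly n a = r * s"
    by (rule quadratic_roots)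
  have root: "r^2 = poly m a * r - poly n a" "s^2 = poly m a * s - poly n a"
    unfolding rs by (simp_all add: algebra_simps power2_eq_square)
  \<comment> \<open>By Vieta, the norm at \<open>a\<close> is the product of the values of
    \<open>g\<close> at the two roots.\<close>
  have "poly N a = g a r * g a s"
    unfolding pq[OF root(1)] pq[OF root(2)] N_def
    by (simp add: rs algebra_simps power2_eq_square)
  with a root have "N \<noteq> 0" by auto
  then have "finite {x. poly N x = 0}" by (rule poly_roots_finite)
  moreover have "poly N x = 0" if c: "c^2 = poly m x * c - poly n x" and "g x c = 0" for x c
  proof -
    \<comment> \<open>The root conjugate to \<open>c\<close> is \<open>poly m x - c\<close>; the
      last summand is zero on the curve.\<close>
    have "poly N x = (poly p x + poly q x * c) * (poly p x + poly q x * (poly m x - c))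
        + (poly q x)^2 * (c^2 - (poly m x * c - poly n x))"
      unfolding N_def by (simp add: algebra_simps power2_eq_square)
    also have "\<dots> = g x c * (poly p x + poly q x * (poly m x - c))"
      by (simp only: c pq[OF c]) simp
    finally show ?thesis using that(2) by simp
  qed
  ultimately show ?thesis by (auto elim: finite_subset[rotated])
qed

text \<open>The value at \<open>c\<close> of a monic quadratic has as modulus the product of the
  distances from \<open>c\<close> to the two roots. So the nearer root has squared distance at most
  that modulus, which tends to zero.\<close>

lemma root_continuity:
  fixes m n :: "nat \<Rightarrow> complex"
  assumes "(\<lambda>k. c^2 - m k * c + n k) \<longlonglongrightarrow> 0"
  shows "\<exists>r. (\<forall>k. r k ^ 2 - m k * r k + n k = 0) \<and> r \<longlonglongrightarrow> c"
proof -
  have "\<exists>r. r^2 - m k * r + n k = 0 \<and> (norm (r - c))^2 \<le> norm (c^2 - m k * c + n k)" for k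
  proof -
    obtain r s where rs: "m k = r + s" "n k = r * s"
      by (rule quadratic_roots)
    have root: "r^2 - m k * r + n k = 0" "s^2 - m k * s + n k = 0"
      unfolding rs by (simp_all add: algebra_simps power2_eq_square)
    have eq: "norm (c^2 - m k * c + n k) = norm (r - c) * norm (s - c)"
      unfolding rs norm_mult[symmetric] by (simp add: algebra_simps power2_eq_square)
    show ?thesis
    proof (cases "norm (r - c) \<le> norm (s - c)")
      case True
      then have "(norm (r - c))^2 \<le> norm (r - c) * norm (s - c)"
        by (simp add: power2_eq_square mult_left_mono)
      with root eq show ?thesis by metis
    next
      case False
      then have "(norm (s - c))^2 \<le> norm (r - c) * norm (s - c)"
        by (simp add: power2_eq_square mult_right_mono)
      with root eq show ?thesis by metis
    qed
  qed
  then obtain r where r: "\<And>k. r k ^ 2 - m k * r k + n k = 0"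
    "\<And>k. (norm (r k - c))^2 \<le> norm (c^2 - m k * c + n k)"
    by metis
  have "(\<lambda>k. (norm (r k - c))^2) \<longlonglongrightarrow> 0"
  proof (rule tendsto_sandwich[OF _ _ tendsto_const tendsto_norm_zero[OF assms]])
    show "eventually (\<lambda>k. (norm (r k - c))^2 \<le> norm (c^2 - m k * c + n k)) sequentially"
      using r(2) by (intro always_eventually allI)
  qed simp
  then have "(\<lambda>k. sqrt ((norm (r k - c))^2)) \<longlonglongrightarrow> sqrt 0"
    by (rule tendsto_real_sqrt)
  then have "r \<longlonglongrightarrow> c"
    by (simp add: LIM_zero_iff tendsto_norm_zero_iff)
  with r(1) show ?thesis by blast
qed

lemma affine_on_det3:
  assumes "\<And>i. affine_on m n (\<lambda>x c. u x c $ i)" "\<And>i. affine_on m n (\<lambda>x c. v x c $ i)"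
    "\<And>i. affine_on m n (\<lambda>x c. w x c $ i)"
  shows "affine_on m n (\<lambda>x c. det3 (u x c) (v x c) (w x c))"
  unfolding det3_expand by (intro affine_on_intros assms)

lemma affine_on_cross3c:
  assumes "\<And>i. affine_on m n (\<lambda>x c. u x c $ i)" "\<And>i. affine_on m n (\<lambda>x c. v x c $ i)"
  shows "affine_on m n (\<lambda>x c. cross3c (u x c) (v x c) $ i)"
proof -
  have "i = 1 \<or> i = 2 \<or> i = 3" using exhaust_3 by blast
  then show ?thesis by (elim disjE; simp; intro affine_on_intros assms)
qed

lemma affine_on_vec3:
  assumes "affine_on m n f" "affine_on m n g" "affine_on m n h"
  shows "affine_on m n (\<lambda>x c. vec3 (f x c) (g x c) (h x c) $ i)"
proof -
  have "i = 1 \<or> i = 2 \<or> i = 3" using exhaust_3 by blast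
  then show ?thesis by (elim disjE) (simp_all add: assms)
qed

lemma affine_on_cfg_Pl:
  assumes "k \<in> {1..8}"
  shows "affine_on m n (\<lambda>x c. cfg (poly t x) (poly b x) c (Pl k) $ i)"
  using label_cases[OF assms]
  by (elim disjE; simp only: cfg_Pl; intro affine_on_vec3 affine_on_intros)

lemma affine_on_axis_cfg:
  assumes "k \<in> {1..8}"
  shows "affine_on m n (\<lambda>x c. axis (cfg (poly t x) (poly b x) c) k $ i)"
  using label_cases[OF assms]
  by (elim disjE; simp only: axis_numeral; intro affine_on_cross3c affine_on_cfg_Pl; simp)

lemma affine_on_ext_cfg:
  assumes "e \<in> ground"
  shows "affine_on m n (\<lambda>x c. ext (cfg (poly t x) (poly b x) c) e $ i)"
  using assms by (cases e) (simp_all add: affine_on_cfg_Pl affine_on_axis_cfg)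

section \<open>Continuity of the normal form and openness of the nonvanishing conditions\<close>

lemma tendsto_vec_3: "(f \<longlongrightarrow> l) F \<longleftrightarrow>
    ((\<lambda>x. f x $ 1) \<longlongrightarrow> l $ 1) F \<and> ((\<lambda>x. f x $ 2) \<longlongrightarrow> l $ 2) F \<and> ((\<lambda>x. f x $ 3) \<longlongrightarrow> l $ 3) F"
  for f :: "'a \<Rightarrow> complex^3"
proof
  assume "(f \<longlongrightarrow> l) F"
  then show "((\<lambda>x. f x $ 1) \<longlongrightarrow> l $ 1) F \<and> ((\<lambda>x. f x $ 2) \<longlongrightarrow> l $ 2) F \<and> ((\<lambda>x. f x $ 3) \<longlongrightarrow> l $ 3) F"
    by (intro conjI tendsto_vec_nth)
next
  assume *: "((\<lambda>x. f x $ 1) \<longlongrightarrow> l $ 1) F \<and> ((\<lambda>x. f x $ 2) \<longlongrightarrow> l $ 2) F \<and> ((\<lambda>x. f x $ 3) \<longlongrightarrow> l $ 3) F"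
  have "((\<lambda>x. f x $ i) \<longlongrightarrow> l $ i) F" for i
    using exhaust_3[of i] * by (elim disjE) simp_all
  then show "(f \<longlongrightarrow> l) F"
    by (rule vec_tendstoI)
qed

lemma tendsto_vec3:
  assumes "(f \<longlongrightarrow> x) F" "(g \<longlongrightarrow> y) F" "(h \<longlongrightarrow> z) F"
  shows "((\<lambda>k. vec3 (f k) (g k) (h k)) \<longlongrightarrow> vec3 x y z) F"
  using assms by (simp add: tendsto_vec_3)

lemma tendsto_cfg:
  assumes "(t \<longlongrightarrow> t') F" "(b \<longlongrightarrow> b') F" "(c \<longlongrightarrow> c') F" and e: "e \<in> ground"
  shows "((\<lambda>k. cfg (t k) (b k) (c k) e) \<longlongrightarrow> cfg t' b' c' e) F"
proof (cases e)
  case (Ul k)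
  then have "k \<in> {1..8}" using e by simp
  from label_cases[OF this] show ?thesis unfolding Ul
    by (elim disjE; simp only: cfg_Ul; intro tendsto_vec3 tendsto_intros assms)
next
  case (Pl k)
  then have "k \<in> {1..8}" using e by simp
  from label_cases[OF this] show ?thesis unfolding Pl
    by (elim disjE; simp only: cfg_Pl; intro tendsto_vec3 tendsto_intros assms)
qed

lemma tendsto_det3:
  assumes "(u \<longlongrightarrow> u') F" "(v \<longlongrightarrow> v') F" "(w \<longlongrightarrow> w') F"
  shows "((\<lambda>k. det3 (u k) (v k) (w k)) \<longlongrightarrow> det3 u' v' w') F"
  unfolding det3_expand by (intro tendsto_intros assms)

lemma tendsto_frame_map_scale:
  assumes "(x \<longlongrightarrow> x') F"
  shows "((\<lambda>k. r *s frame_map u v w (x k)) \<longlongrightarrow> r *s frame_map u v w x') F"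
  unfolding tendsto_vec_3 frame_map_def vector_smult_component vector_add_component
  by (intro conjI tendsto_intros assms)

lemma eventually_nonzero_minors:
  assumes "\<And>e. e \<in> ground \<Longrightarrow> ((\<lambda>k. L k e) \<longlongrightarrow> L' e) F" and "nonzero_minors L'"
  shows "eventually (\<lambda>k. nonzero_minors (L k)) F"
proof -
  have "eventually (\<lambda>k. distinct [p, q, r] \<longrightarrow> \<not> nonbasis {p, q, r} \<longrightarrow>
      det3 (L k p) (L k q) (L k r) \<noteq> 0) F"
    if "p \<in> ground" "q \<in> ground" "r \<in> ground" for p q r
  proof (cases "distinct [p, q, r] \<and> \<not> nonbasis {p, q, r}")
    case True
    then have "det3 (L' p) (L' q) (L' r) \<noteq> 0"
      using assms(2) that unfolding nonzero_minors_def by blast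
    moreover have "((\<lambda>k. det3 (L k p) (L k q) (L k r)) \<longlongrightarrow> det3 (L' p) (L' q) (L' r)) F"
      by (intro tendsto_det3 assms(1) that)
    ultimately have "eventually (\<lambda>k. det3 (L k p) (L k q) (L k r) \<noteq> 0) F"
      by (rule tendsto_imp_eventually_ne[rotated])
    then show ?thesis by (rule eventually_mono) simp
  qed auto
  then show ?thesis
    unfolding nonzero_minors_def by (intro eventually_ball_finite ballI finite_ground)
qed

lemma tendsto_polyfun:
  assumes "f \<in> polyfun" "\<And>v. ((\<lambda>k. x k v) \<longlongrightarrow> x' v) F"
  shows "((\<lambda>k. f (x k)) \<longlongrightarrow> f x') F"
  using assms(1) by induction (auto intro: tendsto_intros assms(2))

section \<open>A nondegenerate member of the family\<close>

text \<open>At \<open>(t, b) = (-1, 2)\<close> the quadratic relation is \<open>c\<^sup>2 = 9 c - 2\<close>. A pair \<open>(p, q)\<close> stands for the class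
  of \<open>p + q c\<close> in \<open>\<int>[c]\<close> modulo 7, and \<open>rnonzero\<close> tests its norm, so it covers both roots \<open>c\<close>.\<close>
type_synonym res = "int \<times> int"
type_synonym rvec = "res \<times> res \<times> res"

fun rmul :: "res \<Rightarrow> res \<Rightarrow> res" where
  "rmul (p, q) (p', q') = ((p * p' - 2 * q * q') mod 7, (p * q' + q * p' + 9 * q * q') mod 7)"

fun radd :: "res \<Rightarrow> res \<Rightarrow> res" where
  "radd (p, q) (p', q') = ((p + p') mod 7, (q + q') mod 7)"

fun rsub :: "res \<Rightarrow> res \<Rightarrow> res" where
  "rsub (p, q) (p', q') = ((p - p') mod 7, (q - q') mod 7)"

fun rnonzero :: "res \<Rightarrow> bool" where
  "rnonzero (p, q) \<longleftrightarrow> (p * p + 9 * p * q + 2 * q * q) mod 7 \<noteq> 0"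

fun rcross :: "rvec \<Rightarrow> rvec \<Rightarrow> rvec" where
  "rcross (x, y, z) (x', y', z') = (rsub (rmul y z') (rmul z y'), rsub (rmul z x') (rmul x z'),
    rsub (rmul x y') (rmul y x'))"

fun rdet :: "rvec \<Rightarrow> rvec \<Rightarrow> rvec \<Rightarrow> res" where
  "rdet (x, y, z) v w = (case rcross v w of (x', y', z') \<Rightarrow>
    radd (radd (rmul x x') (rmul y y')) (rmul z z'))"

text \<open>A relation between classes and complex numbers, so the integers \<open>p\<close>,
  \<open>q\<close> may be any lifts and no uniqueness of the expression \<open>p + q c\<close> has
  to be shown.\<close>

definition rep :: "complex \<Rightarrow> res \<Rightarrow> complex \<Rightarrow> bool" where
  "rep c r z \<longleftrightarrow> (\<exists>p q. z = of_int p + of_int q * c \<and> [p = fst r] (mod 7) \<and> [q = snd r] (mod 7))"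

lemma rep_mult:
  assumes c: "c^2 = 9 * c - 2" and "rep c r z" "rep c r' z'"
  shows "rep c (rmul r r') (z * z')"
proof -
  from assms(2,3) obtain p q p' q' where
    z: "z = of_int p + of_int q * c" "z' = of_int p' + of_int q' * c" and
    cong: "[p = fst r] (mod 7)" "[q = snd r] (mod 7)" "[p' = fst r'] (mod 7)" "[q' = snd r'] (mod 7)"
    unfolding rep_def by metis
  have "z * z' = of_int p * of_int p' + (of_int p * of_int q' + of_int q * of_int p') * c
      + of_int q * of_int q' * c^2"
    unfolding z by (simp add: algebra_simps power2_eq_square)
  then have "z * z' = of_int (p * p' - 2 * q * q') + of_int (p * q' + q * p' + 9 * q * q') * c"
    unfolding c by (simp add: algebra_simps)
  moreover have "[p * p' - 2 * q * q' = fst (rmul r r')] (mod 7)"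
    "[p * q' + q * p' + 9 * q * q' = snd (rmul r r')] (mod 7)"
    by (cases r; cases r'; use cong in \<open>simp add: cong_mod_right cong_add cong_diff cong_mult\<close>)+
  ultimately show ?thesis unfolding rep_def by blast
qed

lemma rep_add:
  assumes "rep c r z" "rep c r' z'"
  shows "rep c (radd r r') (z + z')"
proof -
  from assms obtain p q p' q' where
    z: "z = of_int p + of_int q * c" "z' = of_int p' + of_int q' * c" and
    cong: "[p = fst r] (mod 7)" "[q = snd r] (mod 7)" "[p' = fst r'] (mod 7)" "[q' = snd r'] (mod 7)"
    unfolding rep_def by metis
  have "z + z' = of_int (p + p') + of_int (q + q') * c"
    unfolding z by (simp add: algebra_simps)
  moreover have "[p + p' = fst (radd r r')] (mod 7)" "[q + q' = snd (radd r r')] (mod 7)"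
    by (cases r; cases r'; use cong in \<open>simp add: cong_mod_right cong_add\<close>)+
  ultimately show ?thesis unfolding rep_def by blast
qed

lemma rep_diff:
  assumes "rep c r z" "rep c r' z'"
  shows "rep c (rsub r r') (z - z')"
proof -
  from assms obtain p q p' q' where
    z: "z = of_int p + of_int q * c" "z' = of_int p' + of_int q' * c" and
    cong: "[p = fst r] (mod 7)" "[q = snd r] (mod 7)" "[p' = fst r'] (mod 7)" "[q' = snd r'] (mod 7)"
    unfolding rep_def by metis
  have "z - z' = of_int (p - p') + of_int (q - q') * c"
    unfolding z by (simp add: algebra_simps)
  moreover have "[p - p' = fst (rsub r r')] (mod 7)" "[q - q' = snd (rsub r r')] (mod 7)"
    by (cases r; cases r'; use cong in \<open>simp add: cong_mod_right cong_diff\<close>)+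
  ultimately show ?thesis unfolding rep_def by blast
qed

text \<open>If \<open>p + q c\<close> were zero, so would be its product with the conjugate
  \<open>p + q (9 - c)\<close>. That product is the integer norm, which is nonzero modulo 7.\<close>

lemma rep_nonzero:
  assumes c: "c^2 = 9 * c - 2" and "rep c r z" "rnonzero r"
  shows "z \<noteq> 0"
proof
  assume "z = 0"
  obtain p q where pq: "z = of_int p + of_int q * c"
    and cong: "[p = fst r] (mod 7)" "[q = snd r] (mod 7)"
    using assms(2) unfolding rep_def by blast
  have "(of_int (p * p + 9 * p * q + 2 * q * q) :: complex) =
      (of_int p + of_int q * c) * (of_int p + of_int q * (9 - c)) +
      of_int q * of_int q * (c^2 - (9 * c - 2))"
    by (simp add: algebra_simps power2_eq_square)
  also have "\<dots> = 0"
    unfolding c pq[symmetric] \<open>z = 0\<close> by simp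
  finally have "p * p + 9 * p * q + 2 * q * q = 0" by (simp only: of_int_eq_0_iff)
  moreover have "[p * p + 9 * p * q + 2 * q * q =
      fst r * fst r + 9 * fst r * snd r + 2 * snd r * snd r] (mod 7)"
    by (intro cong_add cong_mult cong cong_refl)
  ultimately show False using assms(3) by (cases r) (simp add: cong_def)
qed

definition rep_vec :: "complex \<Rightarrow> rvec \<Rightarrow> complex^3 \<Rightarrow> bool" where
  "rep_vec c v z \<longleftrightarrow> (case v of (r1, r2, r3) \<Rightarrow> rep c r1 (z$1) \<and> rep c r2 (z$2) \<and> rep c r3 (z$3))"

lemma rep_vec_cross:
  assumes "c^2 = 9 * c - 2" "rep_vec c v z" "rep_vec c v' z'"
  shows "rep_vec c (rcross v v') (cross3c z z')"
  using assms(2,3) unfolding rep_vec_def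
  by (cases v; cases v') (simp add: rep_diff rep_mult[OF assms(1)])

lemma rep_det:
  assumes "c^2 = 9 * c - 2" "rep_vec c u x" "rep_vec c v y" "rep_vec c w z"
  shows "rep c (rdet u v w) (det3 x y z)"
proof -
  obtain r1 r2 r3 where u: "u = (r1, r2, r3)" by (rule prod_cases3)
  obtain s1 s2 s3 where vw: "rcross v w = (s1, s2, s3)" by (rule prod_cases3)
  have "rep c r1 (x$1)" "rep c r2 (x$2)" "rep c r3 (x$3)"
    "rep c s1 (cross3c y z $ 1)" "rep c s2 (cross3c y z $ 2)" "rep c s3 (cross3c y z $ 3)"
    using assms(2) rep_vec_cross[OF assms(1,3,4)] by (simp_all add: rep_vec_def u vw)
  then show ?thesis
    unfolding det3_def dot3_def u rdet.simps vw prod.case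
    by (intro rep_add rep_mult[OF assms(1)])
qed

section \<open>Checking a symmetric property once per unordered triple\<close>

fun all_pairs :: "('a \<Rightarrow> 'a \<Rightarrow> bool) \<Rightarrow> 'a list \<Rightarrow> bool" where
  "all_pairs P [] \<longleftrightarrow> True"
| "all_pairs P (x # xs) \<longleftrightarrow> list_all (P x) xs \<and> all_pairs P xs"

fun all_triples :: "('a \<Rightarrow> 'a \<Rightarrow> 'a \<Rightarrow> bool) \<Rightarrow> 'a list \<Rightarrow> bool" where
  "all_triples P [] \<longleftrightarrow> True"
| "all_triples P (x # xs) \<longleftrightarrow> all_pairs (P x) xs \<and> all_triples P xs"

lemma all_pairsD:
  assumes "all_pairs P xs" "\<And>a b. P a b \<Longrightarrow> P b a" "a \<in> set xs" "b \<in> set xs" "a \<noteq> b"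
  shows "P a b"
  using assms by (induction xs) (auto simp: list_all_iff)

text \<open>The check covers each triple only in list order; the two adjacent transpositions
  generate all other orders.\<close>

lemma all_triplesD:
  assumes "all_triples P xs" "\<And>a b c. P a b c \<Longrightarrow> P b a c" "\<And>a b c. P a b c \<Longrightarrow> P a c b"
    and "a \<in> set xs" "b \<in> set xs" "c \<in> set xs" "distinct [a, b, c]"
  shows "P a b c"
  using assms(1,4-7)
proof (induction xs)
  case (Cons x xs)
  have pairs: "P x d e" if "d \<in> set xs" "e \<in> set xs" "d \<noteq> e" for d e
    using all_pairsD[of "P x" xs d e] Cons.prems(1) assms(3) that by simp
  consider "a = x" | "b = x" | "c = x" | "a \<in> set xs" "b \<in> set xs" "c \<in> set xs"
    using Cons.prems by auto
  then show ?case
  proof cases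
    case 1
    then show ?thesis using pairs[of b c] Cons.prems by auto
  next
    case 2
    then show ?thesis using assms(2)[OF pairs[of a c]] Cons.prems by auto
  next
    case 3
    then show ?thesis using assms(3)[OF assms(2)[OF pairs[of a b]]] Cons.prems by auto
  next
    case 4
    then show ?thesis using Cons by simp
  qed
qed simp

lemma all_pairs_mono: "all_pairs P xs \<Longrightarrow> (\<And>a b. a \<in> set xs \<Longrightarrow> b \<in> set xs \<Longrightarrow> P a b \<Longrightarrow> Q a b) \<Longrightarrow> all_pairs Q xs"
  by (induction xs) (auto simp: list_all_iff)

lemma all_triples_mono:
  "all_triples P xs \<Longrightarrow> (\<And>a b c. a \<in> set xs \<Longrightarrow> b \<in> set xs \<Longrightarrow> c \<in> set xs \<Longrightarrow> P a b c \<Longrightarrow> Q a b c)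
    \<Longrightarrow> all_triples Q xs"
  by (induction xs) (auto elim!: all_pairs_mono)

lemma all_pairs_map: "all_pairs P (map f xs) \<longleftrightarrow> all_pairs (\<lambda>a b. P (f a) (f b)) xs"
  by (induction xs) (auto simp: list_all_iff)

lemma all_triples_map: "all_triples P (map f xs) \<longleftrightarrow> all_triples (\<lambda>a b c. P (f a) (f b) (f c)) xs"
  by (induction xs) (auto simp: all_pairs_map)

text \<open>The lines \<open>cfg (-1) 2 c (Pl k)\<close>, reduced by the quadratic relation and
  modulo 7.\<close>

definition base_Pl :: "rvec list" where
  "base_Pl = [((1,0), (4,0), (0,2)), ((1,6), (0,1), (5,1)), ((5,6), (6,0), (3,5)),
    ((6,1), (2,0), (0,0)), ((1,0), (1,0), (1,0)), ((0,1), (4,3), (0,5)), ((5,0), (5,6), (0,5)),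
    ((0,0), (0,0), (1,0))]"

definition base_axis :: "rvec list" where
  "base_axis = (let q = (\<lambda>i j. rcross (base_Pl ! (i - 1)) (base_Pl ! (j - 1))) in
    [rcross (q 1 8) (q 2 7), rcross (q 1 7) (q 2 6), rcross (q 1 6) (q 2 5),
     rcross (q 1 5) (q 2 4), rcross (q 1 4) (q 2 3), rcross (q 1 3) (q 4 8),
     rcross (q 1 2) (q 3 8), rcross (q 2 8) (q 3 7)])"

lemma base_axis: "base_axis = [((4,2), (2,1), (2,3)), ((5,1), (0,5), (3,5)), ((0,4), (3,1), (0,5)), ((1,3), (5,0), (6,5)), ((0,6), (0,6), (0,4)), ((6,4), (0,1), (5,6)), ((4,5), (4,2), (5,0)), ((2,6), (5,2), (5,4))]"
  by code_simp

text \<open>Executable, and tuned to the order of \<open>base_table\<close>: unprimed labels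
  increase and precede the primed ones, as in \<open>Spairs\<close>. Only the implication to
  \<open>nonbasis\<close> matters.\<close>

fun nonbasis_code :: "lab \<Rightarrow> lab \<Rightarrow> lab \<Rightarrow> bool" where
  "nonbasis_code (Ul i) (Ul j) (Pl k) \<longleftrightarrow> (i, j) \<in> Spairs k"
| "nonbasis_code _ _ _ \<longleftrightarrow> False"

definition base_table :: "(lab \<times> rvec) list" where
  "base_table = [(Ul 1, ((1,0), (4,0), (0,2))),
    (Ul 2, ((1,6), (0,1), (5,1))),
    (Ul 3, ((5,6), (6,0), (3,5))),
    (Ul 4, ((6,1), (2,0), (0,0))),
    (Ul 5, ((1,0), (1,0), (1,0))),
    (Ul 6, ((0,1), (4,3), (0,5))),
    (Ul 7, ((5,0), (5,6), (0,5))),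
    (Ul 8, ((0,0), (0,0), (1,0))),
    (Pl 1, ((4,2), (2,1), (2,3))),
    (Pl 2, ((5,1), (0,5), (3,5))),
    (Pl 3, ((0,4), (3,1), (0,5))),
    (Pl 4, ((1,3), (5,0), (6,5))),
    (Pl 5, ((0,6), (0,6), (0,4))),
    (Pl 6, ((6,4), (0,1), (5,6))),
    (Pl 7, ((4,5), (4,2), (5,0))),
    (Pl 8, ((2,6), (5,2), (5,4)))]"

text \<open>The finite computation behind nondegeneracy: 560 unordered triples, of which 28 are
  nonbases. Working modulo 7 keeps the integers small.\<close>

lemma base_table_check:
  "all_triples (\<lambda>(a, u) (b, v) (c, w). rnonzero (rdet u v w) \<or> nonbasis_code a b c) base_table"
  by code_simp

lemma rep_vec_reduce:
  assumes "z = vec3 (of_int p1 + of_int q1 * c) (of_int p2 + of_int q2 * c) (of_int p3 + of_int q3 * c)"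
  shows "rep_vec c ((p1 mod 7, q1 mod 7), (p2 mod 7, q2 mod 7), (p3 mod 7, q3 mod 7)) z"
  unfolding rep_vec_def rep_def assms prod.case vec3_nth fst_conv snd_conv
  by (metis cong_mod_right cong_refl)

lemma rep_vec_base_Pl:
  assumes c: "c^2 = 9 * c - 2" and k: "k \<in> {1..8}"
  shows "rep_vec c (base_Pl ! (k - 1)) (cfg (-1) 2 c (Pl k))"
proof -
  have cc: "c * c = 9 * c - 2" using c by (simp add: power2_eq_square)
  have
    "cfg (-1) 2 c (Pl 1) = vec3 (of_int 1 + of_int 0 * c) (of_int 4 + of_int 0 * c) (of_int 0 + of_int 2 * c)"
    "cfg (-1) 2 c (Pl 2) = vec3 (of_int 1 + of_int (-1) * c) (of_int 0 + of_int 1 * c) (of_int (-2) + of_int 8 * c)"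
    "cfg (-1) 2 c (Pl 3) = vec3 (of_int (-2) + of_int (-1) * c) (of_int (-8) + of_int 0 * c) (of_int (-4) + of_int (-2) * c)"
    "cfg (-1) 2 c (Pl 4) = vec3 (of_int (-1) + of_int 1 * c) (of_int 2 + of_int 0 * c) (of_int 0 + of_int 0 * c)"
    "cfg (-1) 2 c (Pl 5) = vec3 (of_int 1 + of_int 0 * c) (of_int 1 + of_int 0 * c) (of_int 1 + of_int 0 * c)"
    "cfg (-1) 2 c (Pl 6) = vec3 (of_int 0 + of_int 1 * c) (of_int 4 + of_int (-4) * c) (of_int 0 + of_int (-2) * c)"
    "cfg (-1) 2 c (Pl 7) = vec3 (of_int (-2) + of_int 0 * c) (of_int (-2) + of_int (-1) * c) (of_int 0 + of_int (-2) * c)"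
    "cfg (-1) 2 c (Pl 8) = vec3 (of_int 0 + of_int 0 * c) (of_int 0 + of_int 0 * c) (of_int 1 + of_int 0 * c)"
    unfolding cfg_Pl by (simp_all add: vec_eq_3 algebra_simps cc)
  note * = this[THEN rep_vec_reduce]
  from label_cases[OF k] show ?thesis
    by (elim disjE; use * in \<open>simp add: base_Pl_def\<close>)
qed

lemma rep_vec_base_axis:
  assumes c: "c^2 = 9 * c - 2" and k: "k \<in> {1..8}"
  shows "rep_vec c (base_axis ! (k - 1)) (axis (cfg (-1) 2 c) k)"
proof -
  have q: "rep_vec c (rcross (rcross (base_Pl ! (i - 1)) (base_Pl ! (j - 1)))
      (rcross (base_Pl ! (g - 1)) (base_Pl ! (h - 1))))
    (cross3c (cross3c (cfg (-1) 2 c (Pl i)) (cfg (-1) 2 c (Pl j)))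
      (cross3c (cfg (-1) 2 c (Pl g)) (cfg (-1) 2 c (Pl h))))"
    if "i \<in> {1..8}" "j \<in> {1..8}" "g \<in> {1..8}" "h \<in> {1..8}" for i j g h
    by (intro rep_vec_cross[OF c] rep_vec_base_Pl[OF c] that)
  show ?thesis
    using label_cases[OF k]
  proof (elim disjE)
    assume "k = 1" then show ?thesis
      using q[of 1 8 2 7] by (simp only: axis_numeral) (simp add: base_axis_def)
  next
    assume "k = 2" then show ?thesis
      using q[of 1 7 2 6] by (simp only: axis_numeral) (simp add: base_axis_def)
  next
    assume "k = 3" then show ?thesis
      using q[of 1 6 2 5] by (simp only: axis_numeral) (simp add: base_axis_def)
  next
    assume "k = 4" then show ?thesis
      using q[of 1 5 2 4] by (simp only: axis_numeral) (simp add: base_axis_def)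
  next
    assume "k = 5" then show ?thesis
      using q[of 1 4 2 3] by (simp only: axis_numeral) (simp add: base_axis_def)
  next
    assume "k = 6" then show ?thesis
      using q[of 1 3 4 8] by (simp only: axis_numeral) (simp add: base_axis_def)
  next
    assume "k = 7" then show ?thesis
      using q[of 1 2 3 8] by (simp only: axis_numeral) (simp add: base_axis_def)
  next
    assume "k = 8" then show ?thesis
      using q[of 2 8 3 7] by (simp only: axis_numeral) (simp add: base_axis_def)
  qed
qed

lemma base_table:
  assumes c: "c^2 = 9 * c - 2" and e: "(e, v) \<in> set base_table"
  shows "rep_vec c v (ext (cfg (-1) 2 c) e)"
proof -
  have eq: "base_table = zip (map Ul [1..<9] @ map Pl [1..<9]) (base_Pl @ base_axis)"
    unfolding base_axis by (simp add: base_table_def base_Pl_def upt_rec)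
  have "length base_Pl = 8" "length base_axis = 8"
    by (simp_all add: base_Pl_def base_axis_def Let_def)
  with e obtain k where k: "k \<in> {1..8}"
    and "(e, v) = (Ul k, base_Pl ! (k - 1)) \<or> (e, v) = (Pl k, base_axis ! (k - 1))"
    unfolding eq by (auto simp: set_zip nth_append)
  then show ?thesis
    using rep_vec_base_Pl[OF c k] rep_vec_base_axis[OF c k] by auto
qed

lemma nonbasis_code: "nonbasis_code a b c \<Longrightarrow> nonbasis {a, b, c}"
  by (cases "(a, b, c)" rule: nonbasis_code.cases) (auto simp: nonbasis_def)

lemma nonzero_minors_base:
  assumes c: "c^2 = 9 * c - 2"
  shows "nonzero_minors (ext (cfg (-1) 2 c))"
proof -
  let ?L = "ext (cfg (-1) 2 c)"
  let ?P = "\<lambda>p q r. nonbasis {p, q, r} \<or> det3 (?L p) (?L q) (?L r) \<noteq> 0"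
  have "all_triples (\<lambda>x y z. ?P (fst x) (fst y) (fst z)) base_table"
  proof (rule all_triples_mono[OF base_table_check])
    fix x y z assume m: "x \<in> set base_table" "y \<in> set base_table" "z \<in> set base_table"
      and *: "(\<lambda>(a, u) (b, v) (c, w). rnonzero (rdet u v w) \<or> nonbasis_code a b c) x y z"
    have "rep c (rdet (snd x) (snd y) (snd z)) (det3 (?L (fst x)) (?L (fst y)) (?L (fst z)))"
      by (intro rep_det[OF c] base_table[OF c]) (simp_all add: m)
    moreover have "rnonzero (rdet (snd x) (snd y) (snd z)) \<or> nonbasis_code (fst x) (fst y) (fst z)"
      using * by (simp only: split_beta)
    ultimately show "?P (fst x) (fst y) (fst z)"
      using nonbasis_code rep_nonzero[OF c] by blast
  qed
  then have all: "all_triples ?P (map fst base_table)"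
    by (simp only: all_triples_map)
  have sub: "ground \<subseteq> set (map fst base_table)"
  proof
    fix e assume e: "e \<in> ground"
    then obtain k where "k \<in> {1..8}" "e = Ul k \<or> e = Pl k" by (auto simp: ground_def)
    then show "e \<in> set (map fst base_table)"
      using label_cases[of k] unfolding base_table_def by (elim disjE) simp_all
  qed
  have sym: "?P q p r" "?P p r q" if "?P p q r" for p q r
    using that det3_eq_0_perm(1,2)[of "?L q" "?L p" "?L r"] det3_eq_0_perm(2)[of "?L p" "?L r" "?L q"]
    by (auto simp: insert_commute)
  show ?thesis
    unfolding nonzero_minors_def
  proof (intro ballI impI)
    fix p q r assume g: "p \<in> ground" "q \<in> ground" "r \<in> ground"
      and d: "distinct [p, q, r]" and nb: "\<not> nonbasis {p, q, r}"
    have "?P p q r"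
      by (rule all_triplesD[where P="?P", OF all sym sub[THEN subsetD, OF g(1)]
          sub[THEN subsetD, OF g(2)] sub[THEN subsetD, OF g(3)] d])
    with nb show "det3 (?L p) (?L q) (?L r) \<noteq> 0" by simp
  qed
qed

section \<open>Density of the good realizations\<close>

text \<open>\<open>ext\<close> commutes with projective maps up to factors and concurrency is
  projectively invariant, so the identities for the normal form suffice.\<close>

lemma incidences_ext:
  assumes "realization L"
  shows "incidences (ext L)"
proof -
  obtain u v w s t b c where c: "curve t b c = 0" and "proj_image u v w s L (cfg t b c)"
    by (rule normal_form[OF assms])
  then obtain r where "proj_image u v w r (ext L) (ext (cfg t b c))"
    using ext_proj_image by blast
  then show ?thesis
    using incidences_ext_cfg[OF c] proj_image_invariance(2) by blast
qed

text \<open>The approximation works at every realization and on either branch of the curve, because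
  the sequence of roots is chosen to converge to the given \<open>c\<close>.\<close>

lemma good_near_realization:
  assumes "realization L"
  shows "\<exists>M. (\<forall>e\<in>ground. (\<lambda>k. M k e) \<longlonglongrightarrow> L e) \<and>
    eventually (\<lambda>k. realization (M k) \<and> nonzero_minors (ext (M k))) sequentially"
proof -
  obtain u v w s t b c where c: "curve t b c = 0" and L: "proj_image u v w s L (cfg t b c)"
    by (rule normal_form[OF assms])
  \<comment> \<open>The line through \<open>(t, b)\<close> at \<open>x = 0\<close> and
    \<open>(-1, 2)\<close> at \<open>x = 1\<close>.\<close>
  define T B where "T = [:t, -1 - t:]" and "B = [:b, 2 - b:]"
  define m n where "m = T^2 * B^2 - T * B^2 + T + B" and "n = T^2 * B"
  have curve: "curve (poly T x) (poly B x) z = z^2 - poly m x * z + poly n x" for x z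
    by (simp add: curve_def m_def n_def)
  define Z where "Z p q r = {x. \<exists>z. z^2 = poly m x * z - poly n x \<and>
      det3 (ext (cfg (poly T x) (poly B x) z) p) (ext (cfg (poly T x) (poly B x) z) q)
        (ext (cfg (poly T x) (poly B x) z) r) = 0}" for p q r
  have fin: "finite (Z p q r)"
    if g: "p \<in> ground" "q \<in> ground" "r \<in> ground"
      and d: "distinct [p, q, r]" "\<not> nonbasis {p, q, r}" for p q r
    unfolding Z_def
  proof (rule affine_on_finite_zeros[where a=1])
    show "affine_on m n (\<lambda>x z. det3 (ext (cfg (poly T x) (poly B x) z) p)
        (ext (cfg (poly T x) (poly B x) z) q) (ext (cfg (poly T x) (poly B x) z) r))"
      by (intro affine_on_det3 affine_on_ext_cfg g)
  next
    fix z assume "z^2 = poly m 1 * z - poly n 1"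
    \<comment> \<open>At \<open>(-1, 2)\<close> the coefficients \<open>m\<close> and
      \<open>n\<close> take the values 9 and 2.\<close>
    then have "z^2 = 9 * z - 2" by (simp add: m_def n_def T_def B_def)
    then have "nonzero_minors (ext (cfg (-1) 2 z))" by (rule nonzero_minors_base)
    moreover have "poly T 1 = -1" "poly B 1 = 2" by (simp_all add: T_def B_def)
    ultimately show "det3 (ext (cfg (poly T 1) (poly B 1) z) p) (ext (cfg (poly T 1) (poly B 1) z) q)
        (ext (cfg (poly T 1) (poly B 1) z) r) \<noteq> 0"
      using g d unfolding nonzero_minors_def by simp
  qed
  \<comment> \<open>A null sequence that is injective, so it eventually leaves each of the finite
    sets of bad parameters.\<close>
  define x :: "nat \<Rightarrow> complex" where "x = (\<lambda>k. of_real (inverse (real (Suc k))))"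
  have x0: "x \<longlonglongrightarrow> 0"
    using tendsto_of_real[OF LIMSEQ_inverse_real_of_nat, where 'a=complex]
    by (simp only: x_def of_real_0)
  have "inj x" by (rule injI) (simp add: x_def)
  have avoid: "eventually (\<lambda>k. x k \<notin> A) sequentially" if "finite A" for A
  proof -
    have "finite (x -` A)" by (rule finite_vimageI[OF that \<open>inj x\<close>])
    then obtain K where "\<forall>k\<in>x -` A. k \<le> K" using finite_nat_set_iff_bounded_le by blast
    then show ?thesis by (intro eventually_sequentiallyI[of "Suc K"]) (metis not_less_eq_eq vimageI2)
  qed
  have TB: "(\<lambda>k. poly T (x k)) \<longlonglongrightarrow> t" "(\<lambda>k. poly B (x k)) \<longlonglongrightarrow> b"
    using tendsto_poly[OF x0, of T] tendsto_poly[OF x0, of B] by (simp_all add: T_def B_def)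
  have "(\<lambda>k. c^2 - poly m (x k) * c + poly n (x k)) \<longlonglongrightarrow> c^2 - poly m 0 * c + poly n 0"
    by (intro tendsto_intros tendsto_poly x0)
  moreover have "poly T 0 = t" "poly B 0 = b" by (simp_all add: T_def B_def)
  then have "c^2 - poly m 0 * c + poly n 0 = 0"
    using c curve[of 0 c] by simp
  ultimately have lim: "(\<lambda>k. c^2 - poly m (x k) * c + poly n (x k)) \<longlonglongrightarrow> 0" by simp
  from root_continuity[OF lim] obtain z where z: "\<And>k. z k ^ 2 - poly m (x k) * z k + poly n (x k) = 0" "z \<longlonglongrightarrow> c"
    by blast
  define N where "N k = cfg (poly T (x k)) (poly B (x k)) (z k)" for k
  \<comment> \<open>Keeping the frame and scalings of \<open>L\<close> makes the vectors themselves
    converge to those of \<open>L\<close>, not only the projective lines.\<close>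
  define M where "M k e = s e *s frame_map u v w (N k e)" for k e
  have N: "(\<lambda>k. N k e) \<longlonglongrightarrow> cfg t b c e" if "e \<in> ground" for e
    unfolding N_def by (intro tendsto_cfg TB z(2) that)
  have M: "(\<lambda>k. M k e) \<longlonglongrightarrow> L e" if "e \<in> ground" for e
    using tendsto_frame_map_scale[OF N[OF that]] L that by (simp add: M_def proj_image_def)
  have "nonzero_minors (cfg t b c)"
    using assms proj_image_invariance(1)[OF L] by (simp add: realization_iff)
  with N have "eventually (\<lambda>k. nonzero_minors (N k)) sequentially"
    by (rule eventually_nonzero_minors)
  moreover have "eventually (\<lambda>k. nonzero_minors (ext (N k))) sequentially"
  proof -
    have "eventually (\<lambda>k. distinct [p, q, r] \<longrightarrow> \<not> nonbasis {p, q, r} \<longrightarrow>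
        det3 (ext (N k) p) (ext (N k) q) (ext (N k) r) \<noteq> 0) sequentially"
      if g: "p \<in> ground" "q \<in> ground" "r \<in> ground" for p q r
    proof (cases "distinct [p, q, r] \<and> \<not> nonbasis {p, q, r}")
      case True
      then have "finite (Z p q r)" using fin g by blast
      then have "eventually (\<lambda>k. x k \<notin> Z p q r) sequentially" by (rule avoid)
      then show ?thesis
      proof (rule eventually_mono)
        fix k assume "x k \<notin> Z p q r"
        moreover have "z k ^ 2 = poly m (x k) * z k - poly n (x k)"
          using z(1)[of k] by (simp add: algebra_simps)
        ultimately show "distinct [p, q, r] \<longrightarrow> \<not> nonbasis {p, q, r} \<longrightarrow>
            det3 (ext (N k) p) (ext (N k) q) (ext (N k) r) \<noteq> 0"
          unfolding Z_def N_def by blast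
      qed
    qed auto
    then show ?thesis
      unfolding nonzero_minors_def by (intro eventually_ball_finite ballI finite_ground)
  qed
  ultimately have "eventually (\<lambda>k. realization (M k) \<and> nonzero_minors (ext (M k))) sequentially"
  proof eventually_elim
    case (elim k)
    have "incidences (N k)"
      unfolding N_def by (rule incidences_cfg) (simp add: curve z(1))
    with elim have "realization (N k)" by (simp add: realization_iff)
    moreover have image: "proj_image u v w s (M k) (N k)"
      using L by (simp add: proj_image_def M_def)
    moreover obtain r where "proj_image u v w r (ext (M k)) (ext (N k))"
      by (rule ext_proj_image[OF image])
    ultimately show ?case
      using elim proj_image_invariance by blast
  qed
  with M show ?thesis by blast
qed

lemma tendsto_coords:
  assumes "\<And>e. e \<in> ground \<Longrightarrow> ((\<lambda>k. M k e) \<longlongrightarrow> L e) F"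
  shows "((\<lambda>k. coords (M k) v) \<longlongrightarrow> coords L v) F"
  by (cases v) (auto simp: coords_def intro!: tendsto_vec_nth assms)

text \<open>Polynomials are continuous, so approximation in the usual topology gives Zariski
  density.\<close>

lemma good_dense:
  assumes L: "realization L" and g: "g \<in> polyfun"
    and zero: "\<And>M. realization M \<Longrightarrow> nonzero_minors (ext M) \<Longrightarrow> g (coords M) = 0"
  shows "g (coords L) = 0"
proof -
  obtain M where M: "\<And>e. e \<in> ground \<Longrightarrow> (\<lambda>k. M k e) \<longlonglongrightarrow> L e"
    and ev: "eventually (\<lambda>k. realization (M k) \<and> nonzero_minors (ext (M k))) sequentially"
    using good_near_realization[OF L] by blast
  have "(\<lambda>k. g (coords (M k))) \<longlonglongrightarrow> g (coords L)"
    by (rule tendsto_polyfun[OF g tendsto_coords[OF M]])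
  moreover have "eventually (\<lambda>k. g (coords (M k)) = 0) sequentially"
    using ev by (rule eventually_mono) (use zero in blast)
  ultimately have "(\<lambda>k. 0) \<longlonglongrightarrow> g (coords L)"
    by (rule Lim_transform_eventually)
  then show ?thesis by (simp add: LIMSEQ_const_iff)
qed

section \<open>The polynomial whose zero set contains the bad realizations\<close>

definition uncoords :: "(lab \<times> 3 \<Rightarrow> complex) \<Rightarrow> lab \<Rightarrow> complex^3" where
  "uncoords x e = (\<chi> i. x (e, i))"

lemma polyfun_diff: "f \<in> polyfun \<Longrightarrow> g \<in> polyfun \<Longrightarrow> (\<lambda>x. f x - g x) \<in> polyfun"
  using padd[OF _ pmult[OF pconst[of "-1"]]] by fastforce

lemma polyfun_prod:
  assumes "finite A" "\<And>a. a \<in> A \<Longrightarrow> f a \<in> polyfun"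
  shows "(\<lambda>x. \<Prod>a\<in>A. f a x) \<in> polyfun"
  using assms by (induction A) (auto intro: pconst pmult)

lemma polyfun_det3:
  assumes "\<And>i. (\<lambda>x. u x $ i) \<in> polyfun" "\<And>i. (\<lambda>x. v x $ i) \<in> polyfun"
    "\<And>i. (\<lambda>x. w x $ i) \<in> polyfun"
  shows "(\<lambda>x. det3 (u x) (v x) (w x)) \<in> polyfun"
  unfolding det3_expand by (intro padd pmult polyfun_diff assms)

lemma polyfun_cross3c:
  assumes "\<And>i. (\<lambda>x. u x $ i) \<in> polyfun" "\<And>i. (\<lambda>x. v x $ i) \<in> polyfun"
  shows "(\<lambda>x. cross3c (u x) (v x) $ i) \<in> polyfun"
proof -
  have "i = 1 \<or> i = 2 \<or> i = 3" using exhaust_3 by blast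
  then show ?thesis by (elim disjE; simp; intro pmult polyfun_diff assms)
qed

lemma polyfun_uncoords: "(\<lambda>x. uncoords x e $ i) \<in> polyfun"
  unfolding uncoords_def vec_lambda_beta by (rule pvar)

lemma polyfun_ext_uncoords:
  assumes "e \<in> ground"
  shows "(\<lambda>x. ext (uncoords x) e $ i) \<in> polyfun"
proof (cases e)
  case (Ul k)
  then show ?thesis by (simp add: polyfun_uncoords)
next
  case (Pl k)
  then have "k \<in> {1..8}" using assms by simp
  from label_cases[OF this] show ?thesis
    unfolding Pl ext_simps
    by (elim disjE; simp only: axis_numeral; intro polyfun_cross3c polyfun_uncoords)
qed

text \<open>\<open>coords\<close> forgets the values outside \<open>ground\<close>; this shows that
  \<open>ext\<close> does not see them at ground labels, so it can be computed from
  coordinates.\<close>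

lemma ext_cong:
  assumes "\<And>e. e \<in> ground \<Longrightarrow> L e = N e" "e \<in> ground"
  shows "ext L e = ext N e"
proof (cases e)
  case (Ul k)
  then show ?thesis using assms by simp
next
  case (Pl k)
  then have "k \<in> {1..8}" using assms by simp
  from label_cases[OF this] show ?thesis
    unfolding Pl ext_simps by (elim disjE; simp only: axis_numeral; simp add: assms(1))
qed

definition minors_poly :: "(lab \<times> 3 \<Rightarrow> complex) \<Rightarrow> complex" where
  "minors_poly x = (\<Prod>(p, q, r)\<in>{(p, q, r). p \<in> ground \<and> q \<in> ground \<and> r \<in> ground \<and>
      distinct [p, q, r] \<and> \<not> nonbasis {p, q, r}}.
    det3 (ext (uncoords x) p) (ext (uncoords x) q) (ext (uncoords x) r))"

lemma finite_triples: "finite {(p, q, r). p \<in> ground \<and> q \<in> ground \<and> r \<in> ground \<and>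
    distinct [p, q, r] \<and> \<not> nonbasis {p, q, r}}"
  by (rule finite_subset[of _ "ground \<times> ground \<times> ground"]) auto

lemma minors_poly_polyfun: "minors_poly \<in> polyfun"
proof -
  have "(\<lambda>x. case a of (p, q, r) \<Rightarrow> det3 (ext (uncoords x) p) (ext (uncoords x) q) (ext (uncoords x) r)) \<in> polyfun"
    if "a \<in> {(p, q, r). p \<in> ground \<and> q \<in> ground \<and> r \<in> ground \<and> distinct [p, q, r] \<and> \<not> nonbasis {p, q, r}}" for a
    using that by (cases a) (auto intro!: polyfun_det3 polyfun_ext_uncoords)
  from polyfun_prod[OF finite_triples this] show ?thesis
    unfolding minors_poly_def[abs_def] by simp
qed

lemma minors_poly_nonzero: "minors_poly (coords L) \<noteq> 0 \<longleftrightarrow> nonzero_minors (ext L)"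
proof -
  have e: "ext (uncoords (coords L)) e = ext L e" if "e \<in> ground" for e
    by (rule ext_cong[OF _ that]) (simp add: uncoords_def coords_def vec_eq_iff)
  show ?thesis
    unfolding minors_poly_def prod_zero_iff[OF finite_triples] nonzero_minors_def
    using e by fastforce
qed

section \<open>The operator \<open>Lambda\<close> yields the computed axes\<close>

lemma axis_from_Spairs:
  assumes "k \<in> {1..8}"
  shows "\<exists>(i, j)\<in>Spairs k. \<exists>(g, h)\<in>Spairs k.
    axis L k = cross3c (cross3c (L (Pl i)) (L (Pl j))) (cross3c (L (Pl g)) (L (Pl h)))"
  using label_cases[OF assms]
  by (elim disjE; simp only: axis_numeral; simp add: Spairs_def)

text \<open>The incidences put the axis through all of S_k. It is the nonzero cross product of two
  points of S_k, so any line through S_k is proportional to it, and the vector chosen in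
  \<open>Lambda\<close> differs from it by a factor only.\<close>

lemma Lambda_axis:
  assumes inc: "incidences (ext L)" and nz: "nonzero_minors (ext L)" and k: "k \<in> {1..8}"
  obtains v r where "Lambda (\<lambda>k. L (Pl k)) k = Some v" "r \<noteq> 0" "v = r *s axis L k"
proof -
  let ?C = "\<lambda>k. L (Pl k)"
  have ax: "axis L k \<noteq> 0"
    using nonzero_minors_imp_nonzero[OF nz, of "Pl k"] k by simp
  have line: "line_through_S ?C k (axis L k)"
    unfolding line_through_S_def
  proof (intro conjI ballI ax)
    fix p assume "p \<in> Sset ?C k"
    then obtain i j where "(i, j) \<in> Spairs k" "p = cross3c (L (Pl i)) (L (Pl j))"
      by (auto simp: Sset_def ipt_def)
    with inc show "dot3 (axis L k) p = 0"
      by (auto simp: incidences_def dot3_cross3c)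
  qed
  have unique: "same_proj (axis L k) v" if v: "line_through_S ?C k v" for v
  proof -
    obtain i j g h where s: "(i, j) \<in> Spairs k" "(g, h) \<in> Spairs k"
      and eq: "axis L k = cross3c (cross3c (L (Pl i)) (L (Pl j))) (cross3c (L (Pl g)) (L (Pl h)))"
      using axis_from_Spairs[OF k] by blast
    have "cross3c (L (Pl i)) (L (Pl j)) \<in> Sset ?C k" "cross3c (L (Pl g)) (L (Pl h)) \<in> Sset ?C k"
      using s by (auto simp: Sset_def ipt_def)
    with v show ?thesis
      unfolding eq line_through_S_def by (intro same_proj_cross3c) blast+
  qed
  let ?v = "SOME v. line_through_S ?C k v"
  have v: "line_through_S ?C k ?v" using line by (rule someI)
  then have "?v \<noteq> 0" by (simp add: line_through_S_def)
  then obtain r where r: "r \<noteq> 0" "?v = r *s axis L k"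
    by (rule same_proj_scaleE[OF unique[OF v] ax])
  have "Lambda ?C k = Some ?v"
    unfolding Lambda_def using line unique by (intro if_P) blast
  then show ?thesis using r that by blast
qed

theorem theorem4p3:
  shows "holds_generically realization
    (\<lambda>A0. let C1 = (\<lambda>k. A0 (Pl k)) in
       (\<forall>k\<in>{1..8}. Lambda C1 k \<noteq> None) \<and>
       realization (\<lambda>e. case e of Ul k \<Rightarrow> C1 k | Pl k \<Rightarrow> the (Lambda C1 k)))"
  unfolding holds_generically_def
proof (intro exI[of _ "{minors_poly}"] conjI ballI impI allI)
  show "{minors_poly} \<subseteq> polyfun" using minors_poly_polyfun by simp
next
  fix g L
  assume g: "g \<in> polyfun" and L: "realization L"
    and zero: "\<forall>L. realization L \<and> \<not> (\<forall>f\<in>{minors_poly}. f (coords L) = 0) \<longrightarrow> g (coords L) = 0"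
  show "g (coords L) = 0"
  proof (rule good_dense[OF L g])
    fix M assume "realization M" "nonzero_minors (ext M)"
    with zero show "g (coords M) = 0"
      using minors_poly_nonzero[of M] by blast
  qed
next
  fix L
  assume "realization L \<and> \<not> (\<forall>f\<in>{minors_poly}. f (coords L) = 0)"
  then have L: "realization L" and nz: "nonzero_minors (ext L)"
    using minors_poly_nonzero[of L] by blast+
  note inc = incidences_ext[OF L]
  let ?C = "\<lambda>k. L (Pl k)"
  let ?L' = "\<lambda>e. case e of Ul k \<Rightarrow> ?C k | Pl k \<Rightarrow> the (Lambda ?C k)"
  \<comment> \<open>The arrangement built with \<open>Lambda\<close> agrees with
    \<open>ext L\<close> up to a scalar for each line, and realizations are invariant under such
    scalings.\<close>
  have "\<exists>r. r \<noteq> 0 \<and> ?L' e = r *s ext L e" if "e \<in> ground" for e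
  proof (cases e)
    case (Ul k)
    then show ?thesis by (intro exI[of _ 1]) simp
  next
    case (Pl k)
    then have "k \<in> {1..8}" using that by simp
    from Lambda_axis[OF inc nz this] show ?thesis unfolding Pl by (metis ext_simps(2) lab.simps(6) option.sel)
  qed
  then obtain r where "\<And>e. e \<in> ground \<Longrightarrow> r e \<noteq> 0 \<and> ?L' e = r e *s ext L e"
    by metis
  then have "realization ?L' \<longleftrightarrow> realization (ext L)"
    by (rule scaling_invariance)
  then have "realization ?L'" using inc nz by (simp add: realization_iff)
  moreover have "\<forall>k\<in>{1..8}. Lambda ?C k \<noteq> None"
    using Lambda_axis[OF inc nz] by (metis option.distinct(1))
  ultimately show "let C1 = ?C in (\<forall>k\<in>{1..8}. Lambda C1 k \<noteq> None) \<and>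
      realization (\<lambda>e. case e of Ul k \<Rightarrow> C1 k | Pl k \<Rightarrow> the (Lambda C1 k))"
    by simp
qed

end
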